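(* Let $\alpha\in(0,1/2)$. Any (randomized) algorithm that, given {\textsc{COND-EVAL}} access to an unknown distribution $D$ on $[n]$ and $\epsilon=n^{-\alpha}$, estimates $\ell_2^2(D)=\sum_{j\in[n]}D(j)^2$ within a multiplicative $(1+\epsilon)$-factor with probability at least $2/3$, must make $\Omega\!\left(\frac{1}{\epsilon^2\log(1/\epsilon)}\right)$ queries to the {\textsc{COND-EVAL}} oracle.
   Context: For a distribution $D$ on $[n]=\{1,\dots,n\}$ and $S\subseteq[n]$, $D(S)=\sum_{i\in S}D(i)$. A {\textsc{COND-EVAL}} oracle for $D$ takes as input any set $S\subseteq[n]$ (possibly chosen adaptively); if $D(S)>0$ it returns $(j,D(j),D(j)/D(S))$ where $j\in S$ is drawn with probability $D(j)/D(S)$, and if $D(S)=0$ it returns "failure". The guarantee must hold for every distribution $D$ on $[n]$. *)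

theory Defs
  imports "HOL-Probability.Probability"
begin

text \<open>
  A distribution on \<open>[n] = {1..n}\<close> is a \<open>nat pmf\<close> supported in \<open>{1..n}\<close>.
  The oracle answer \<open>None\<close> is ``failure''.
\<close>

definition distributions_on :: "nat \<Rightarrow> nat pmf set" where
  "distributions_on n = {D. set_pmf D \<subseteq> {1..n}}"

type_synonym answer = "(nat \<times> real \<times> real) option"

definition cond_eval :: "nat pmf \<Rightarrow> nat set \<Rightarrow> answer pmf" where
  "cond_eval D S =
     (if measure_pmf.prob D S > 0
      then map_pmf (\<lambda>j. Some (j, pmf D j, pmf D j / measure_pmf.prob D S)) (cond_pmf D S)
      else return_pmf None)"

text \<open>
  Adaptive randomized oracle algorithms as decision trees: \<open>Query S k\<close> queries the set \<open>S\<close> and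
  continues with \<open>k a\<close> on answer \<open>a\<close>; \<open>Random p\<close> draws the rest of the algorithm from \<open>p\<close>.
  The final output is an arbitrary Borel probability measure on the reals, so that the estimate
  may use non-discrete randomness. For the choice of queries discrete randomness is fully general:
  there are only finitely many subsets of \<open>[n]\<close>, and for a given distribution only finitely
  many answers to each query.
\<close>

datatype algorithm =
    Output "real measure"
  | Random "algorithm pmf"
  | Query "nat set" "answer \<Rightarrow> algorithm"

inductive algorithm_on :: "nat \<Rightarrow> algorithm \<Rightarrow> bool" for n where
  "prob_space \<mu> \<Longrightarrow> sets \<mu> = sets borel \<Longrightarrow> algorithm_on n (Output \<mu>)"
| "(\<forall>A\<in>set_pmf p. algorithm_on n A) \<Longrightarrow> algorithm_on n (Random p)"
| "S \<subseteq> {1..n} \<Longrightarrow> (\<forall>a. algorithm_on n (k a)) \<Longrightarrow> algorithm_on n (Query S k)"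

text \<open>
  The joint distribution of the output measure reached and the number of oracle queries made,
  when the oracle is the one for \<open>D\<close>.
\<close>

primrec run :: "nat pmf \<Rightarrow> algorithm \<Rightarrow> (real measure \<times> nat) pmf" where
  "run D (Output \<mu>) = return_pmf (\<mu>, 0)"
| "run D (Random p) = join_pmf (map_pmf (run D) p)"
| "run D (Query S k) =
     bind_pmf (cond_eval D S) (\<lambda>a. map_pmf (\<lambda>(\<mu>, m). (\<mu>, Suc m)) (run D (k a)))"

definition output_prob :: "nat pmf \<Rightarrow> algorithm \<Rightarrow> real set \<Rightarrow> real" where
  "output_prob D A X = measure_pmf.expectation (run D A) (\<lambda>(\<mu>, m). measure \<mu> X)"

definition l2_sq :: "nat \<Rightarrow> nat pmf \<Rightarrow> real" where
  "l2_sq n D = (\<Sum>j\<in>{1..n}. (pmf D j)\<^sup>2)"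

definition estimates_l2_sq :: "nat \<Rightarrow> real \<Rightarrow> algorithm \<Rightarrow> bool" where
  "estimates_l2_sq n \<epsilon> A \<longleftrightarrow>
     (\<forall>D\<in>distributions_on n.
        output_prob D A {x. l2_sq n D / (1 + \<epsilon>) \<le> x \<and> x \<le> (1 + \<epsilon>) * l2_sq n D} \<ge> 2 / 3)"

definition makes_at_most_queries :: "nat \<Rightarrow> algorithm \<Rightarrow> nat \<Rightarrow> bool" where
  "makes_at_most_queries n A q \<longleftrightarrow>
     (\<forall>D\<in>distributions_on n. \<forall>(\<mu>, m)\<in>set_pmf (run D A). m \<le> q)"

end

theory Submission
  imports Defs
begin

text \<open>
  For sign vectors \<open>x, y \<in> {-1, 1}\<^sup>N\<close>, with \<open>N\<close> of order \<open>1 / \<epsilon>\<^sup>2\<close>, put a distribution on \<open>2 N\<close> points whose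
  weights are determined by \<open>x + y\<close> and whose squared norm is an affine function of the inner product
  \<open>s = \<langle>x, y\<rangle>\<close>. An accurate estimate then tells \<open>s\<^sup>2 < N\<close> from \<open>s\<^sup>2 > N\<close>, except in a narrow window.
  Every oracle answer confines \<open>(x, y)\<close> to one of polynomially many combinatorial rectangles, on which
  it has constant probability, so a run with \<open>q\<close> queries ends in a rectangle \<open>X \<times> Y\<close> of density
  \<open>n\<^bsup>-O(q)\<^esup>\<close>, up to a negligible error. An entropy argument shows that the mean of \<open>s\<^sup>2\<close> over any
  rectangle of density \<open>\<delta>\<close> is at least \<open>N - 2 ln (1 / \<delta>)\<close>. Hence, if \<open>q\<close> is small compared with
  \<open>N / ln n\<close>, the mean of \<open>s\<^sup>2 - N\<close> over the inputs for which the algorithm reports ``small'', weighted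
  by the probability of that report, is nearly nonnegative. But for a correct algorithm it is at most
  \<open>-(2/3) E (N - s\<^sup>2)\<^sup>+ + (1/3) E (s\<^sup>2 - N)\<^sup>+\<close>, up to a small error, and the two expectations agree and are
  of order \<open>N\<close>, a contradiction.
\<close>

subsection \<open>Entropy on the discrete cube\<close>

definition cube :: "nat \<Rightarrow> real list set" where
  "cube n = {x. length x = n \<and> set x \<subseteq> {-1, 1}}"

definition ip :: "real list \<Rightarrow> real list \<Rightarrow> real" where
  "ip x y = sum_list (map2 (*) x y)"

lemma ip_simps [simp]: "ip [] y = 0" "ip x [] = 0" "ip (a # x) (b # y) = a * b + ip x y"
  by (simp_all add: ip_def)

lemma cube_0 [simp]: "cube 0 = {[]}"
  by (auto simp: cube_def)

lemma cube_Suc: "cube (Suc n) = (#) 1 ` cube n \<union> (#) (-1) ` cube n"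
  by (auto simp: cube_def length_Suc_conv)

lemma finite_cube [simp]: "finite (cube n)"
  by (induction n) (auto simp: cube_Suc)

lemma sum_cube_Suc:
  "sum f (cube (Suc n)) = (\<Sum>x\<in>cube n. f (1 # x)) + (\<Sum>x\<in>cube n. f (-1 # x))"
proof -
  have "sum f (cube (Suc n)) = sum f ((#) 1 ` cube n) + sum f ((#) (-1) ` cube n)"
    unfolding cube_Suc by (rule sum.union_disjoint) auto
  then show ?thesis
    by (simp add: sum.reindex)
qed

text \<open>Pinsker's inequality for one bit of bias \<open>u\<close>, doubled. Both sides and their
  first derivatives agree at \<open>0\<close>, so it follows by comparing derivatives twice.\<close>

lemma entropy_two_point_unit:
  fixes u :: real
  assumes "0 \<le> u" "u < 1"
  shows "u\<^sup>2 \<le> (1 + u) * ln (1 + u) + (1 - u) * ln (1 - u)"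
proof -
  have 1: "2 * v \<le> ln (1 + v) - ln (1 - v)" if "0 \<le> v" "v < 1" for v :: real
  proof -
    have "(\<lambda>v. ln (1 + v) - ln (1 - v) - 2 * v) 0 \<le> (\<lambda>v. ln (1 + v) - ln (1 - v) - 2 * v) v"
    proof (rule DERIV_nonneg_imp_nondecreasing[OF that(1)])
      fix t :: real assume t: "0 \<le> t" "t \<le> v"
      have "((\<lambda>v. ln (1 + v) - ln (1 - v) - 2 * v) has_real_derivative
          (1 / (1 + t) + 1 / (1 - t) - 2)) (at t)"
        using t that by (auto intro!: derivative_eq_intros)
      moreover have "0 \<le> 1 / (1 + t) + 1 / (1 - t) - 2"
      proof -
        have "1 / (1 + t) + 1 / (1 - t) - 2 = 2 * t\<^sup>2 / ((1 + t) * (1 - t))"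
        proof -
          have "1 + t \<noteq> 0" "1 - t \<noteq> 0" using t that by auto
          then show ?thesis by (simp add: divide_simps) (simp add: algebra_simps power2_eq_square)
        qed
        also have "\<dots> \<ge> 0" using t that by simp
        finally show ?thesis .
      qed
      ultimately show "\<exists>y. ((\<lambda>v. ln (1 + v) - ln (1 - v) - 2 * v) has_real_derivative y) (at t)
          \<and> 0 \<le> y"
        by blast
    qed
    then show ?thesis by simp
  qed
  let ?g = "\<lambda>u. (1 + u) * ln (1 + u) + (1 - u) * ln (1 - u) - u\<^sup>2"
  have "?g 0 \<le> ?g u"
  proof (rule DERIV_nonneg_imp_nondecreasing[OF assms(1)])
    fix t :: real assume t: "0 \<le> t" "t \<le> u"
    have "(?g has_real_derivative (ln (1 + t) - ln (1 - t) - 2 * t)) (at t)"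
      using t assms by (auto intro!: derivative_eq_intros)
    then show "\<exists>y. (?g has_real_derivative y) (at t) \<and> 0 \<le> y"
      using 1[of t] t assms by force
  qed
  then show ?thesis by simp
qed

text \<open>The homogeneous form of the one-bit bound: divide by half the mass \<open>a + b\<close>
  and put \<open>u = (a - b) / (a + b)\<close>.\<close>

lemma entropy_two_point:
  fixes a b :: real
  assumes "0 \<le> a" "0 \<le> b"
  shows "(a - b)\<^sup>2 / (2 * (a + b)) \<le> a * ln a + b * ln b - (a + b) * ln ((a + b) / 2)"
proof -
  have main: "(a - b)\<^sup>2 / (2 * (a + b)) \<le> a * ln a + b * ln b - (a + b) * ln ((a + b) / 2)"
    if ab: "0 \<le> b" "b \<le> a" for a b :: real
  \<comment> \<open>Here \<open>u\<close> would be \<open>1\<close>, outside the range of the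
    one-bit bound; the claim reduces to \<open>1 / 2 \<le> ln 2\<close>.\<close>
  proof (cases "b = 0")
    case True
    have "1 / 2 \<le> ln (2::real)" using ln_le_minus_one[of "1 / 2 :: real"] by (simp add: ln_div)
    then have "a * (1 / 2) \<le> a * ln 2" using ab True by (intro mult_left_mono) auto
    moreover have "a * ln a - a * ln (a / 2) = a * ln 2"
      using ab True by (cases "a = 0") (auto simp: ln_div algebra_simps)
    ultimately show ?thesis using True by (simp add: power2_eq_square)
  next
    case False
    define s where "s = a + b"
    define u where "u = (a - b) / s"
    have s: "s > 0" using ab False by (simp add: s_def)
    have a: "a = s / 2 * (1 + u)" and b: "b = s / 2 * (1 - u)"
      using s by (simp_all add: u_def s_def field_simps)
    have u: "0 \<le> u" "u < 1" using ab False s by (auto simp: u_def s_def)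
    have la: "ln a = ln (s / 2) + ln (1 + u)" and lb: "ln b = ln (s / 2) + ln (1 - u)"
        unfolding a b using s u ln_mult_pos[of "s / 2" "1 + u"] ln_mult_pos[of "s / 2" "1 - u"] by simp_all
    have "a * ln a + b * ln b - s * ln (s / 2)
      = s / 2 * ((1 + u) * ln (1 + u) + (1 - u) * ln (1 - u))"
    proof -
      have "a * ln a + b * ln b - s * ln (s / 2)
        = (a + b - s) * ln (s / 2) + a * ln (1 + u) + b * ln (1 - u)"
        unfolding la lb by (simp add: algebra_simps)
      also have "\<dots> = a * ln (1 + u) + b * ln (1 - u)" by (simp add: s_def)
      also have "\<dots> = s / 2 * ((1 + u) * ln (1 + u) + (1 - u) * ln (1 - u))"
        by (subst a, subst b) (simp add: field_simps)
      finally show ?thesis .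
    qed
    also have "\<dots> \<ge> s / 2 * u\<^sup>2"
      using entropy_two_point_unit[OF u] s by (intro mult_left_mono) auto
    also have "s / 2 * u\<^sup>2 = (a - b)\<^sup>2 / (2 * s)"
      using s by (simp add: u_def field_simps power2_eq_square)
    finally show ?thesis by (simp add: s_def)
  qed
  show ?thesis
    using main[of b a] main[of a b] assms
    by (cases "b \<le> a") (simp_all add: add.commute power2_commute)
qed

text \<open>The relative entropy of the density \<open>f\<close> with respect to the uniform distribution, scaled by
  the total mass of \<open>f\<close>.\<close>
definition ent :: "nat \<Rightarrow> (real list \<Rightarrow> real) \<Rightarrow> real" where
  "ent n f = (\<Sum>x\<in>cube n. f x * ln (f x)) - sum f (cube n) * ln (sum f (cube n) / 2 ^ n)"

text \<open>Chain rule with the first coordinate revealed first: beyond the entropies of the two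
  halves there remains exactly the two-point entropy of the masses \<open>F 1\<close> and
  \<open>F (-1)\<close>.\<close>

lemma ent_split_first:
  fixes f :: "real list \<Rightarrow> real" and n :: nat
  assumes "\<And>x. 0 \<le> f x"
  defines "F \<equiv> \<lambda>b. \<Sum>x\<in>cube n. f (b # x)"
  shows "ent n (\<lambda>x. f (1 # x)) + ent n (\<lambda>x. f (-1 # x)) + (F 1 - F (-1))\<^sup>2 / (2 * (F 1 + F (-1)))
    \<le> ent (Suc n) f"
proof -
  have F: "0 \<le> F b" for b unfolding F_def by (rule sum_nonneg) (rule assms)
  have FF: "(\<Sum>x\<in>cube n. f (b # x)) = F b" for b by (simp add: F_def)
  have l: "t * ln (t / 2 ^ n) = t * ln t - t * (n * ln 2)" if "0 \<le> t" for t :: real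
    using that by (cases "t = 0") (auto simp: ln_div ln_realpow algebra_simps)
  have l2: "t * ln (t / 2 ^ Suc n) = t * ln (t / 2) - t * (n * ln 2)" if "0 \<le> t" for t :: real
    using that by (cases "t = 0") (auto simp: ln_div ln_realpow ln_mult algebra_simps)
  have "ent (Suc n) f = ent n (\<lambda>x. f (1 # x)) + ent n (\<lambda>x. f (-1 # x))
    + (F 1 * ln (F 1) + F (-1) * ln (F (-1)) - (F 1 + F (-1)) * ln ((F 1 + F (-1)) / 2))"
    unfolding ent_def sum_cube_Suc FF
    using l[OF F[of 1]] l[OF F[of "-1"]] l2[OF add_nonneg_nonneg[OF F[of 1] F[of "-1"]]]
    by (simp add: algebra_simps del: power_Suc)
  then show ?thesis using entropy_two_point[OF F[of 1] F[of "-1"]] by linarith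
qed

text \<open>Chain rule in the opposite order: the first coordinate is revealed last, so its
  two-point entropy is taken separately for each remainder \<open>y\<close>.\<close>

lemma ent_split_rest:
  assumes "\<And>x. 0 \<le> g x"
  shows "ent n (\<lambda>y. g (1 # y) + g (-1 # y))
    + (\<Sum>y\<in>cube n. (g (1 # y) - g (-1 # y))\<^sup>2 / (2 * (g (1 # y) + g (-1 # y)))) \<le> ent (Suc n) g"
proof -
  define G where "G = (\<Sum>y\<in>cube n. g (1 # y) + g (-1 # y))"
  have G: "0 \<le> G" unfolding G_def by (intro sum_nonneg add_nonneg_nonneg assms)
  have G2: "sum g (cube (Suc n)) = G" unfolding G_def sum_cube_Suc by (simp add: sum.distrib)
  have l: "G * ln (G / 2 ^ Suc n) = G * ln (G / 2 ^ n) - G * ln 2"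
    using G by (cases "G = 0") (auto simp: ln_div ln_realpow ln_mult algebra_simps)
  have l2: "t * ln (t / 2) = t * ln t - t * ln 2" if "0 \<le> t" for t :: real
    using that by (cases "t = 0") (auto simp: ln_div algebra_simps)
  have "(\<Sum>y\<in>cube n. (g (1 # y) - g (-1 # y))\<^sup>2 / (2 * (g (1 # y) + g (-1 # y))))
    \<le> (\<Sum>y\<in>cube n. g (1 # y) * ln (g (1 # y)) + g (-1 # y) * ln (g (-1 # y))
        - (g (1 # y) + g (-1 # y)) * ln ((g (1 # y) + g (-1 # y)) / 2))"
    by (intro sum_mono entropy_two_point assms)
  also have "\<dots> = (\<Sum>y\<in>cube n. g (1 # y) * ln (g (1 # y)) + g (-1 # y) * ln (g (-1 # y))
        - (g (1 # y) + g (-1 # y)) * ln (g (1 # y) + g (-1 # y))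
        + (g (1 # y) + g (-1 # y)) * ln 2)"
    by (intro sum.cong refl) (simp add: l2 assms)
  also have "\<dots> = ent (Suc n) g - ent n (\<lambda>y. g (1 # y) + g (-1 # y))"
    unfolding ent_def G2 G_def[symmetric] l
    unfolding sum_cube_Suc[of "\<lambda>x. g x * ln (g x)"]
    by (simp add: sum.distrib sum_subtractf sum_distrib_right[symmetric] G_def[symmetric]
        del: power_Suc)
      (simp add: G_def sum.distrib distrib_right)
  finally show ?thesis by simp
qed

text \<open>Second moment as squared mean plus variance, for a quantity taking two values with
  weights \<open>p\<close> and \<open>r\<close>; \<open>2 * \<sigma> + (c - d)\<close> is the gap
  between the values.\<close>

lemma two_point_variance:
  fixes p r :: real
  assumes "0 \<le> p" "0 \<le> r"
  shows "p * (\<sigma> + s + c)\<^sup>2 + r * (- \<sigma> + s + d)\<^sup>2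
    = (p + r) * (s + (p * (\<sigma> + c) + r * (- \<sigma> + d)) / (p + r))\<^sup>2
      + p * r / (p + r) * (2 * \<sigma> + (c - d))\<^sup>2"
proof (cases "p + r = 0")
  case True
  then show ?thesis using assms by (simp add: add_nonneg_eq_0_iff)
next
  case False
  then show ?thesis by (simp add: divide_simps) algebra
qed

text \<open>The second moment is at least the variance, which is unaffected by the common shift
  \<open>d\<close>: the shift cannot cancel the gaps \<open>2\<close> and \<open>-2\<close> at
  once.\<close>

lemma two_point_variance_le:
  fixes p r :: real
  assumes "0 \<le> p" "0 \<le> r"
  shows "16 * (p * r / (p + r)) \<le> p * (2 + d)\<^sup>2 + r * (- 2 + d)\<^sup>2"
proof -
  have "0 \<le> (p + r) * (0 + (p * (2 + d) + r * (- 2 + d)) / (p + r))\<^sup>2"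
    using assms by (intro mult_nonneg_nonneg) auto
  then show ?thesis
    using two_point_variance[OF assms, of 2 0 d d] by (simp add: mult.commute)
qed

text \<open>Connects variance with entropy: the deficit \<open>(p - r)\<^sup>2 / (p + r)\<close> is
  twice the lower bound in \<open>entropy_two_point\<close>, whence the factor \<open>2\<close>
  before \<open>ent\<close> below.\<close>

lemma two_point_harmonic:
  fixes p r :: real
  assumes "0 \<le> p" "0 \<le> r"
  shows "4 * (p * r / (p + r)) = (p + r) - (p - r)\<^sup>2 / (p + r)"
proof (cases "p + r = 0")
  case False
  then show ?thesis by (simp add: field_simps power2_eq_square)
qed (use assms in \<open>simp add: add_nonneg_eq_0_iff\<close>)

text \<open>The shift \<open>h\<close> makes the induction go through: the first coordinate of \<open>x\<close> is revealed before
  the others and the first coordinate of \<open>y\<close> after them, and every contribution to the inner product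
  that is already determined at some stage is a function of the remaining part of \<open>y\<close> only.\<close>
lemma ip_second_moment_ge_ent:
  fixes f g h :: "real list \<Rightarrow> real"
  assumes "\<And>x. 0 \<le> f x" "\<And>y. 0 \<le> g y"
  shows "n * sum f (cube n) * sum g (cube n)
      - 2 * sum g (cube n) * ent n f - 2 * sum f (cube n) * ent n g
    \<le> (\<Sum>x\<in>cube n. \<Sum>y\<in>cube n. f x * g y * (ip x y + h y)\<^sup>2)"
  using assms
proof (induction n arbitrary: f g h)
  case 0
  then show ?case by (simp add: ent_def)
next
  case (Suc n)
  note f = Suc.prems(1) and g = Suc.prems(2)
  define F where "F b = (\<Sum>x\<in>cube n. f (b # x))" for b
  define G where "G = (\<Sum>y\<in>cube n. g (1 # y) + g (-1 # y))"
  define g' where "g' y = g (1 # y) + g (-1 # y)" for y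
  \<comment> \<open>\<open>H \<sigma> y\<close> is the conditional mean, given the rest
    \<open>y\<close>, of the first product plus the old shift; it is the shift for the induction
    hypothesis. \<open>K\<close> weights the conditional variance, and \<open>M / 2\<close>,
    \<open>R / 2\<close> bound the entropy gains of the two chain rules.\<close>
  define H where "H \<sigma> y = (g (1 # y) * (\<sigma> + h (1 # y)) + g (-1 # y) * (- \<sigma> + h (-1 # y))) / g' y"
    for \<sigma> y
  define K where "K y = g (1 # y) * g (-1 # y) / g' y" for y
  define \<Delta> where "\<Delta> y = h (1 # y) - h (-1 # y)" for y
  define M where "M = (F 1 - F (-1))\<^sup>2 / (F 1 + F (-1))"
  define R where "R = (\<Sum>y\<in>cube n. (g (1 # y) - g (-1 # y))\<^sup>2 / g' y)"
  define I where "I \<sigma> = (\<Sum>x\<in>cube n. \<Sum>y\<in>cube n. f (\<sigma> # x) * g' y * (ip x y + H \<sigma> y)\<^sup>2)" for \<sigma>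
  have F0: "0 \<le> F b" for b unfolding F_def by (intro sum_nonneg f)
  have g'0: "0 \<le> g' y" for y unfolding g'_def by (intro add_nonneg_nonneg g)
  have K0: "0 \<le> K y" for y unfolding K_def by (intro divide_nonneg_nonneg mult_nonneg_nonneg g g'0)
  have M0: "0 \<le> M" unfolding M_def by (simp add: F0)
  have R0: "0 \<le> R" unfolding R_def by (intro sum_nonneg) (simp add: g'0)
  have Fs: "sum f (cube (Suc n)) = F 1 + F (-1)" by (simp add: F_def sum_cube_Suc)
  have Gs: "sum g (cube (Suc n)) = G" by (simp add: G_def sum_cube_Suc sum.distrib)
  have G': "sum g' (cube n) = G" by (simp add: G_def g'_def)

  have row: "(\<Sum>x\<in>cube n. \<Sum>y\<in>cube (Suc n). f (\<sigma> # x) * g y * (ip (\<sigma> # x) y + h y)\<^sup>2)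
    = I \<sigma> + F \<sigma> * (\<Sum>y\<in>cube n. K y * (2 * \<sigma> + \<Delta> y)\<^sup>2)" for \<sigma>
  proof -
    have "(\<Sum>y\<in>cube (Suc n). f (\<sigma> # x) * g y * (ip (\<sigma> # x) y + h y)\<^sup>2)
      = (\<Sum>y\<in>cube n. f (\<sigma> # x) * g' y * (ip x y + H \<sigma> y)\<^sup>2)
        + f (\<sigma> # x) * (\<Sum>y\<in>cube n. K y * (2 * \<sigma> + \<Delta> y)\<^sup>2)" for x
    proof -
      have "(\<Sum>y\<in>cube (Suc n). f (\<sigma> # x) * g y * (ip (\<sigma> # x) y + h y)\<^sup>2)
        = (\<Sum>y\<in>cube n. f (\<sigma> # x) * (g (1 # y) * (\<sigma> + ip x y + h (1 # y))\<^sup>2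
            + g (-1 # y) * (- \<sigma> + ip x y + h (-1 # y))\<^sup>2))"
        by (simp add: sum_cube_Suc sum.distrib distrib_left mult.assoc)
      also have "\<dots> = (\<Sum>y\<in>cube n. f (\<sigma> # x) * (g' y * (ip x y + H \<sigma> y)\<^sup>2
            + K y * (2 * \<sigma> + \<Delta> y)\<^sup>2))"
        unfolding two_point_variance[OF g g] H_def K_def \<Delta>_def g'_def ..
      finally show ?thesis
        by (simp add: sum.distrib distrib_left mult.assoc sum_distrib_left)
    qed
    then show ?thesis
      by (simp add: I_def F_def sum.distrib sum_distrib_right)
  qed

  \<comment> \<open>The new coordinate should add variance equal to the full mass
    \<open>(F 1 + F (-1)) * G\<close>. The losses \<open>M * G\<close> and
    \<open>(F 1 + F (-1)) * R\<close> are paid for by \<open>ef\<close> and \<open>eg\<close>, and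
    \<open>M * R\<close> has the favourable sign.\<close>
  have "(F 1 + F (-1) - M) * (G - R) = (4 * (F 1 * F (-1) / (F 1 + F (-1)))) * (\<Sum>y\<in>cube n. 4 * K y)"
    unfolding two_point_harmonic[OF F0 F0] K_def g'_def two_point_harmonic[OF g g]
    by (simp add: M_def R_def G_def g'_def sum_subtractf)
  also have "\<dots> = (\<Sum>y\<in>cube n. K y * (16 * (F 1 * F (-1) / (F 1 + F (-1)))))"
    unfolding sum_distrib_left by (intro sum.cong refl) simp
  also have "\<dots> \<le> (\<Sum>y\<in>cube n. K y * (F 1 * (2 + \<Delta> y)\<^sup>2 + F (-1) * (- 2 + \<Delta> y)\<^sup>2))"
    by (intro sum_mono mult_left_mono two_point_variance_le F0 K0)
  also have "\<dots> = F 1 * (\<Sum>y\<in>cube n. K y * (2 * 1 + \<Delta> y)\<^sup>2)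
      + F (-1) * (\<Sum>y\<in>cube n. K y * (2 * (-1) + \<Delta> y)\<^sup>2)"
    by (simp add: sum_distrib_left sum.distrib distrib_left mult_ac)
  finally have var: "(F 1 + F (-1) - M) * (G - R) \<le> F 1 * (\<Sum>y\<in>cube n. K y * (2 * 1 + \<Delta> y)\<^sup>2)
      + F (-1) * (\<Sum>y\<in>cube n. K y * (2 * (-1) + \<Delta> y)\<^sup>2)" .

  have IH: "n * F \<sigma> * G - 2 * G * ent n (\<lambda>x. f (\<sigma> # x)) - 2 * F \<sigma> * ent n g' \<le> I \<sigma>" for \<sigma>
    using Suc.IH[of "\<lambda>x. f (\<sigma> # x)" g' "H \<sigma>"] f g'0 unfolding G' I_def F_def by simp
  have G0: "0 \<le> G" unfolding G'[symmetric] by (intro sum_nonneg g'0)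
  have "(F 1 - F (-1))\<^sup>2 / (2 * (F 1 + F (-1))) = M / 2" by (simp add: M_def)
  then have "ent n (\<lambda>x. f (1 # x)) + ent n (\<lambda>x. f (-1 # x)) + M / 2 \<le> ent (Suc n) f"
    using ent_split_first[of f n, OF f] by (simp only: F_def)
  from mult_left_mono[OF this, of "2 * G"] G0
  have ef: "2 * G * (ent n (\<lambda>x. f (1 # x)) + ent n (\<lambda>x. f (-1 # x))) + G * M \<le> 2 * G * ent (Suc n) f"
    by (simp add: algebra_simps)
  have eg: "2 * (F 1 + F (-1)) * ent n g' + (F 1 + F (-1)) * R \<le> 2 * (F 1 + F (-1)) * ent (Suc n) g"
  proof -
    have "(\<Sum>y\<in>cube n. (g (1 # y) - g (-1 # y))\<^sup>2 / (2 * (g (1 # y) + g (-1 # y)))) = R / 2"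
      by (simp add: R_def g'_def sum_divide_distrib mult.commute)
    then have "ent n g' + R / 2 \<le> ent (Suc n) g"
      using ent_split_rest[of g n, OF g] by (simp add: g'_def[abs_def])
    from mult_left_mono[OF this, of "2 * (F 1 + F (-1))"] F0[of 1] F0[of "-1"]
    show ?thesis by (simp add: algebra_simps)
  qed
  have MR: "0 \<le> M * R" by (intro mult_nonneg_nonneg M0 R0)
  have "(\<Sum>x\<in>cube (Suc n). \<Sum>y\<in>cube (Suc n). f x * g y * (ip x y + h y)\<^sup>2)
    = (I 1 + F 1 * (\<Sum>y\<in>cube n. K y * (2 * 1 + \<Delta> y)\<^sup>2))
      + (I (-1) + F (-1) * (\<Sum>y\<in>cube n. K y * (2 * (-1) + \<Delta> y)\<^sup>2))"
    unfolding sum_cube_Suc[of "\<lambda>x. \<Sum>y\<in>cube (Suc n). f x * g y * (ip x y + h y)\<^sup>2"] row ..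
  also have "\<dots> \<ge> Suc n * (F 1 + F (-1)) * G - 2 * G * ent (Suc n) f
      - 2 * (F 1 + F (-1)) * ent (Suc n) g"
    using var IH[of 1] IH[of "-1"] ef eg MR by (simp add: algebra_simps)
  finally show ?case unfolding Fs Gs .
qed

text \<open>Indicators as densities and the zero shift in \<open>ip_second_moment_ge_ent\<close>:
  the entropy of an indicator is the size of the set times the logarithm of its inverse
  density.\<close>

lemma ip_second_moment_rectangle:
  assumes X: "X \<subseteq> cube n" "X \<noteq> {}" and Y: "Y \<subseteq> cube n" "Y \<noteq> {}"
  shows "card X * card Y * (n + 2 * ln (card X * card Y / 4 ^ n)) \<le> (\<Sum>x\<in>X. \<Sum>y\<in>Y. (ip x y)\<^sup>2)"
proof -
  have ind: "sum (\<lambda>x. indicator Z x :: real) (cube n) = card Z"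
    and ent: "ent n (indicator Z) = - card Z * ln (card Z / 2 ^ n)"
    if "Z \<subseteq> cube n" for Z
  proof -
    show s: "sum (\<lambda>x. indicator Z x :: real) (cube n) = card Z"
      using that by (simp add: indicator_def sum.If_cases Int_absorb1)
    have "indicator Z x * ln (indicator Z x) = (0::real)" for x
      by (simp add: indicator_def)
    then show "ent n (indicator Z) = - card Z * ln (card Z / 2 ^ n)"
      unfolding ent_def s[unfolded eta_contract_eq] by (simp add: s)
  qed
  have indm: "(\<Sum>x\<in>cube n. indicator Z x * \<phi> x) = sum \<phi> Z"
    if "Z \<subseteq> cube n" for Z and \<phi> :: "real list \<Rightarrow> real"
    by (rule sum.mono_neutral_cong_right) (use that in \<open>auto simp: indicator_def\<close>)
  have pos: "0 < card X" "0 < card Y"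
    using X Y finite_subset[OF _ finite_cube] by (auto simp: card_gt_0_iff)
  have "ln (card X * card Y / 4 ^ n) = ln ((card X / 2 ^ n) * (card Y / 2 ^ n) :: real)"
    by (simp add: power_mult_distrib[symmetric])
  also have "\<dots> = ln (card X / 2 ^ n) + ln (card Y / 2 ^ n)"
    using pos by (subst ln_mult) auto
  finally have "card X * card Y * (n + 2 * ln (card X * card Y / 4 ^ n))
    = n * card X * card Y - 2 * card Y * ent n (indicator X) - 2 * card X * ent n (indicator Y)"
    unfolding ent[OF X(1)] ent[OF Y(1)] by (simp add: algebra_simps)
  also have "\<dots> \<le> (\<Sum>x\<in>cube n. \<Sum>y\<in>cube n. indicator X x * indicator Y y * (ip x y)\<^sup>2)"
    using ip_second_moment_ge_ent[of "indicator X" "indicator Y" n "\<lambda>_. 0"]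
    unfolding ind[OF X(1)] ind[OF Y(1)] by simp
  also have "\<dots> = (\<Sum>x\<in>cube n. indicator X x * (\<Sum>y\<in>cube n. indicator Y y * (ip x y)\<^sup>2))"
    by (simp only: sum_distrib_left mult.assoc)
  also have "\<dots> = (\<Sum>x\<in>X. \<Sum>y\<in>Y. (ip x y)\<^sup>2)"
    by (simp add: indm[OF X(1)] indm[OF Y(1)])
  finally show ?thesis .
qed

subsection \<open>Moments of the inner product\<close>

text \<open>One step of a simple random walk: each sign of the product of the first coordinates
  comes from two pairs.\<close>

lemma sum_ip_Suc:
  fixes \<phi> :: "real \<Rightarrow> real"
  shows "(\<Sum>x\<in>cube (Suc n). \<Sum>y\<in>cube (Suc n). \<phi> (ip x y))
    = 2 * (\<Sum>x\<in>cube n. \<Sum>y\<in>cube n. \<phi> (ip x y + 1) + \<phi> (ip x y - 1))"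
  by (simp add: sum_cube_Suc sum.distrib add.commute)

text \<open>Odd powers cancel in \<open>(s + 1) ^ k + (s - 1) ^ k\<close>, so the even moments
  satisfy a closed recursion and are proved simultaneously.\<close>

lemma ip_moments:
  shows ip_moment_0: "(\<Sum>x\<in>cube n. \<Sum>y\<in>cube n. 1) = (4::real) ^ n"
    and ip_moment_2: "(\<Sum>x\<in>cube n. \<Sum>y\<in>cube n. ip x y ^ 2) = real n * 4 ^ n"
    and ip_moment_4: "(\<Sum>x\<in>cube n. \<Sum>y\<in>cube n. ip x y ^ 4) = (3 * real n ^ 2 - 2 * n) * 4 ^ n"
    and ip_moment_6: "(\<Sum>x\<in>cube n. \<Sum>y\<in>cube n. ip x y ^ 6)
      = (15 * real n ^ 3 - 30 * real n ^ 2 + 16 * n) * 4 ^ n"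
proof (induction n)
  case 0
  { case 1 then show ?case by simp next case 2 then show ?case by simp
  next case 3 then show ?case by simp next case 4 then show ?case by simp }
next
  case (Suc n)
  let ?E = "\<lambda>k. \<Sum>x\<in>cube n. \<Sum>y\<in>cube n. ip x y ^ k"
  note E = Suc.IH
  have b2: "(s + 1) ^ 2 + (s - 1) ^ 2 = 2 * s ^ 2 + 2 * 1" for s :: real by algebra
  have b4: "(s + 1) ^ 4 + (s - 1) ^ 4 = 2 * s ^ 4 + 12 * s ^ 2 + 2 * 1" for s :: real by algebra
  have b6: "(s + 1) ^ 6 + (s - 1) ^ 6 = 2 * s ^ 6 + 30 * s ^ 4 + 30 * s ^ 2 + 2 * 1" for s :: real
    by algebra
  { case 1
    show ?case using E(1) unfolding sum_ip_Suc[where \<phi> = "\<lambda>_. 1"] by (simp add: sum.distrib)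
  next
    case 2
    show ?case
      unfolding sum_ip_Suc[where \<phi> = "\<lambda>s. s ^ 2"] b2 sum.distrib sum_distrib_left[symmetric] E
      by (simp add: algebra_simps)
  next
    case 3
    show ?case
      unfolding sum_ip_Suc[where \<phi> = "\<lambda>s. s ^ 4"] b4 sum.distrib sum_distrib_left[symmetric] E
      by (simp add: algebra_simps power2_eq_square)
  next
    case 4
    show ?case
      unfolding sum_ip_Suc[where \<phi> = "\<lambda>s. s ^ 6"] b6 sum.distrib sum_distrib_left[symmetric] E
      by (simp add: algebra_simps power2_eq_square power3_eq_cube)
  }
qed

text \<open>The positive part is bounded below by a polynomial of degree six, whose mean is known
  exactly from \<open>ip_moments\<close>; this replaces a central limit estimate.\<close>

lemma ip_sq_below_mean:
  assumes "4 \<le> n"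
  shows "n / 3 * 4 ^ n \<le> (\<Sum>x\<in>cube n. \<Sum>y\<in>cube n. max 0 (n - (ip x y)\<^sup>2))"
proof -
  have n: "real n \<ge> 4" using assms by simp
  define c4 where "c4 = 13 / (36 * real n)"
  define c6 where "c6 = 1 / (36 * (real n)\<^sup>2)"
  \<comment> \<open>The polynomial \<open>(n - s\<^sup>2) (1 - s\<^sup>2 / 6 n)\<^sup>2\<close> has the sign of \<open>n - s\<^sup>2\<close>, and it is at most
    \<open>n - s\<^sup>2\<close> where that is positive.\<close>
  have pt: "real n * 1 - 4 / 3 * s ^ 2 + c4 * s ^ 4 - c6 * s ^ 6 \<le> max 0 (real n - s\<^sup>2)" for s :: real
  proof -
    define t where "t = 1 - s\<^sup>2 / (6 * n)"
    have "real n * 1 - 4 / 3 * s ^ 2 + c4 * s ^ 4 - c6 * s ^ 6 = (n - s\<^sup>2) * t\<^sup>2"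
      using n unfolding t_def c4_def c6_def
      by (simp add: divide_simps) (simp add: algebra_simps eval_nat_numeral)
    also have "\<dots> \<le> max 0 (real n - s\<^sup>2)"
    proof (cases "s\<^sup>2 \<le> n")
      case True
      then have "0 \<le> t" "t \<le> 1" using n by (auto simp: t_def divide_simps)
      then have "t\<^sup>2 \<le> 1" by (simp add: power_le_one)
      from mult_left_mono[OF this, of "n - s\<^sup>2"] show ?thesis using True by simp
    next
      case False
      then have "(n - s\<^sup>2) * t\<^sup>2 \<le> 0" by (intro mult_nonpos_nonneg) auto
      then show ?thesis by simp
    qed
    finally show ?thesis .
  qed
  \<comment> \<open>The right-hand side is the exact mean of the polynomial;
    \<open>4 \<le> n\<close> makes the correction nonnegative.\<close>
  have "n / 3 \<le> n / 3 + 1 / 9 - 4 / (9 * real n)"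
    using n by (simp add: field_simps)
  also have "\<dots> = n - 4 / 3 * n + c4 * (3 * real n ^ 2 - 2 * n)
      - c6 * (15 * real n ^ 3 - 30 * real n ^ 2 + 16 * n)"
    using n unfolding c4_def c6_def
    by (simp add: divide_simps) (simp add: algebra_simps eval_nat_numeral)
  finally have "n / 3 * 4 ^ n \<le> (n - 4 / 3 * n + c4 * (3 * real n ^ 2 - 2 * n)
      - c6 * (15 * real n ^ 3 - 30 * real n ^ 2 + 16 * n)) * 4 ^ n"
    by (rule mult_right_mono) simp
  also have "\<dots> = (\<Sum>x\<in>cube n. \<Sum>y\<in>cube n.
      real n * 1 - 4 / 3 * ip x y ^ 2 + c4 * ip x y ^ 4 - c6 * ip x y ^ 6)"
    unfolding sum.distrib sum_subtractf sum_distrib_left[symmetric] ip_moments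
    by (simp add: algebra_simps)
  also have "\<dots> \<le> (\<Sum>x\<in>cube n. \<Sum>y\<in>cube n. max 0 (n - (ip x y)\<^sup>2))"
    by (intro sum_mono pt)
  finally show ?thesis .
qed

subsection \<open>Output probabilities\<close>

text \<open>The bounds on \<open>h\<close> are required on the support only, since only output
  measures actually reached are known to be probability measures. The proof passes through
  nonnegative integrals.\<close>

lemma expectation_bind_pmf:
  fixes h :: "'b \<Rightarrow> real"
  assumes h: "\<And>y. y \<in> set_pmf (bind_pmf p f) \<Longrightarrow> 0 \<le> h y \<and> h y \<le> B"
  shows "measure_pmf.expectation (bind_pmf p f) h
    = measure_pmf.expectation p (\<lambda>x. measure_pmf.expectation (f x) h)"
proof -
  have h0: "0 \<le> h y" if "x \<in> set_pmf p" "y \<in> set_pmf (f x)" for x y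
    using h[of y] that by auto
  have int: "integrable (measure_pmf (f x)) h" if "x \<in> set_pmf p" for x
    by (rule measure_pmf.integrable_const_bound[where B = B])
      (use h that in \<open>fastforce simp: AE_measure_pmf_iff\<close>)+
  have "(\<integral>\<^sup>+y. h y \<partial>bind_pmf p f) = (\<integral>\<^sup>+x. \<integral>\<^sup>+y. h y \<partial>f x \<partial>p)"
    by simp
  also have "\<dots> = (\<integral>\<^sup>+x. ennreal (measure_pmf.expectation (f x) h) \<partial>p)"
    by (intro nn_integral_cong_AE, unfold AE_measure_pmf_iff, intro ballI nn_integral_eq_integral int)
      (use h in \<open>auto simp: AE_measure_pmf_iff\<close>)
  finally have "enn2real (\<integral>\<^sup>+y. h y \<partial>bind_pmf p f)
    = enn2real (\<integral>\<^sup>+x. ennreal (measure_pmf.expectation (f x) h) \<partial>p)" by simp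
  moreover have "measure_pmf.expectation (bind_pmf p f) h = enn2real (\<integral>\<^sup>+y. h y \<partial>bind_pmf p f)"
    by (rule integral_eq_nn_integral) (use h in \<open>auto simp: AE_measure_pmf_iff\<close>)
  moreover have "measure_pmf.expectation p (\<lambda>x. measure_pmf.expectation (f x) h)
    = enn2real (\<integral>\<^sup>+x. ennreal (measure_pmf.expectation (f x) h) \<partial>p)"
    by (rule integral_eq_nn_integral)
      (use h0 in \<open>auto simp: AE_measure_pmf_iff intro!: integral_nonneg_AE\<close>)
  ultimately show ?thesis by simp
qed

lemma run_prob_space:
  assumes "algorithm_on n A" "(\<mu>, m) \<in> set_pmf (run D A)"
  shows "prob_space \<mu> \<and> sets \<mu> = sets borel"
  using assms
proof (induction arbitrary: m)
  case (3 S k)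
  then show ?case by fastforce
qed auto

lemma output_prob_Output [simp]: "output_prob D (Output \<mu>) X = measure \<mu> X"
  by (simp add: output_prob_def)

lemma output_prob_Random:
  assumes "algorithm_on n (Random p)"
  shows "output_prob D (Random p) X = measure_pmf.expectation p (\<lambda>A. output_prob D A X)"
proof -
  have "run D (Random p) = bind_pmf p (run D)" by (simp add: bind_eq_join_pmf)
  then show ?thesis
    unfolding output_prob_def
    by (simp only:, intro expectation_bind_pmf[where B = 1])
      (use run_prob_space[OF assms] in \<open>fastforce intro: prob_space.prob_le_1 simp: bind_eq_join_pmf\<close>)
qed

lemma output_prob_Query:
  assumes "algorithm_on n (Query S k)"
  shows "output_prob D (Query S k) X
    = measure_pmf.expectation (cond_eval D S) (\<lambda>a. output_prob D (k a) X)"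
proof -
  have "output_prob D (Query S k) X = measure_pmf.expectation (cond_eval D S)
      (\<lambda>a. measure_pmf.expectation (map_pmf (\<lambda>(\<mu>, m). (\<mu>, Suc m)) (run D (k a))) (\<lambda>(\<mu>, m). measure \<mu> X))"
    unfolding output_prob_def run.simps
    by (intro expectation_bind_pmf[where B = 1])
      (use run_prob_space[OF assms] in \<open>fastforce intro: prob_space.prob_le_1\<close>)
  then show ?thesis by (simp add: output_prob_def case_prod_unfold)
qed

lemma integrable_output:
  assumes "algorithm_on n A"
  shows "integrable (measure_pmf (run D A)) (\<lambda>(\<mu>, m). measure \<mu> X)"
  by (rule measure_pmf.integrable_const_bound[where B = 1])
    (use run_prob_space[OF assms] in
      \<open>fastforce simp: AE_measure_pmf_iff intro: prob_space.prob_le_1\<close>)+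

lemma output_prob_mono:
  assumes "algorithm_on n A" "X \<subseteq> Y" "Y \<in> sets borel"
  shows "output_prob D A X \<le> output_prob D A Y"
  unfolding output_prob_def
proof (rule integral_mono_AE)
  have "measure \<mu> X \<le> measure \<mu> Y" if "(\<mu>, m) \<in> set_pmf (run D A)" for \<mu> m
  proof -
    interpret prob_space \<mu> using run_prob_space[OF assms(1) that] by simp
    show ?thesis
      using run_prob_space[OF assms(1) that] assms by (intro finite_measure_mono) auto
  qed
  then show "AE z in run D A. (case z of (\<mu>, m) \<Rightarrow> measure \<mu> X) \<le> (case z of (\<mu>, m) \<Rightarrow> measure \<mu> Y)"
    by (auto simp: AE_measure_pmf_iff)
qed (rule integrable_output[OF assms(1)])+

lemma output_prob_disjoint:
  assumes "algorithm_on n A" "X \<in> sets borel" "Y \<in> sets borel" "X \<inter> Y = {}"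
  shows "output_prob D A X + output_prob D A Y \<le> 1"
proof -
  have "measure \<mu> X + measure \<mu> Y \<le> 1" if "(\<mu>, m) \<in> set_pmf (run D A)" for \<mu> m
  proof -
    interpret prob_space \<mu> using run_prob_space[OF assms(1) that] by simp
    have "measure \<mu> X + measure \<mu> Y = measure \<mu> (X \<union> Y)"
      using run_prob_space[OF assms(1) that] assms by (intro finite_measure_Union[symmetric]) auto
    then show ?thesis by simp
  qed
  then have "measure_pmf.expectation (run D A)
      (\<lambda>z. (case z of (\<mu>, m) \<Rightarrow> measure \<mu> X) + (case z of (\<mu>, m) \<Rightarrow> measure \<mu> Y)) \<le> 1"
    by (intro measure_pmf.integral_le_const Bochner_Integration.integrable_add
        integrable_output[OF assms(1)]) (auto simp: AE_measure_pmf_iff)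
  then show ?thesis
    unfolding output_prob_def by (simp add: integrable_output[OF assms(1)])
qed

lemma output_prob_bounds:
  assumes "algorithm_on n A"
  shows "0 \<le> output_prob D A X" "output_prob D A X \<le> 1"
proof -
  show "0 \<le> output_prob D A X"
    unfolding output_prob_def by (intro integral_nonneg_AE) auto
  show "output_prob D A X \<le> 1"
    unfolding output_prob_def
    by (intro measure_pmf.integral_le_const integrable_output[OF assms])
      (use run_prob_space[OF assms] in
        \<open>fastforce simp: AE_measure_pmf_iff intro: prob_space.prob_le_1\<close>)
qed

subsection \<open>The hard distributions\<close>

text \<open>Points \<open>j\<close> and \<open>N + j\<close> carry complementary weights, so that the total mass does not depend on
  \<open>x\<close> and \<open>y\<close>.\<close>
definition entry :: "nat \<Rightarrow> nat \<Rightarrow> real list \<Rightarrow> real" where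
  "entry N j x = (if j \<le> N then x ! (j - 1) else - x ! (j - 1 - N))"

text \<open>On the cube the weights are \<open>1\<close>, \<open>2\<close> or \<open>3\<close> over
  \<open>4 * N\<close>; the offset \<open>2\<close> keeps them positive, so the support reveals
  nothing about \<open>x\<close> and \<open>y\<close>.\<close>

definition hard_weight :: "nat \<Rightarrow> real list \<Rightarrow> real list \<Rightarrow> nat \<Rightarrow> real" where
  "hard_weight N x y j =
    (if j \<in> {1..2 * N} then (2 + (entry N j x + entry N j y) / 2) / (4 * N) else 0)"

definition hard_dist :: "nat \<Rightarrow> real list \<Rightarrow> real list \<Rightarrow> nat pmf" where
  "hard_dist N x y = embed_pmf (hard_weight N x y)"

lemma nth_cube:
  assumes "x \<in> cube N" "i < N"
  shows "x ! i \<in> {-1, 1}"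
proof -
  have "x ! i \<in> set x" "set x \<subseteq> {-1, 1}" using assms by (simp_all add: cube_def)
  then show ?thesis by blast
qed

lemma entry_cube:
  assumes "x \<in> cube N" "j \<in> {1..2 * N}"
  shows "entry N j x \<in> {-1, 1}"
  using nth_cube[OF assms(1), of "j - 1"] nth_cube[OF assms(1), of "j - 1 - N"] assms(2)
  by (auto simp: entry_def)

lemma sum_entry:
  fixes \<psi> :: "real \<Rightarrow> real \<Rightarrow> real"
  shows "(\<Sum>j\<in>{1..2 * N}. \<psi> (entry N j x) (entry N j y))
    = (\<Sum>i<N. \<psi> (x ! i) (y ! i) + \<psi> (- x ! i) (- y ! i))"
proof -
  have split: "(\<Sum>i<N + M. \<phi> i) = (\<Sum>i<N. \<phi> i) + (\<Sum>i<M. \<phi> (N + i))" for M and \<phi> :: "nat \<Rightarrow> real"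
    by (induction M) auto
  have "(\<Sum>j\<in>{1..2 * N}. \<psi> (entry N j x) (entry N j y))
    = (\<Sum>i<N + N. \<psi> (entry N (Suc i) x) (entry N (Suc i) y))"
    by (rule sum.reindex_bij_witness[where i = Suc and j = "\<lambda>j. j - 1"]) auto
  also have "\<dots> = (\<Sum>i<N. \<psi> (entry N (Suc i) x) (entry N (Suc i) y))
      + (\<Sum>i<N. \<psi> (entry N (Suc (N + i)) x) (entry N (Suc (N + i)) y))"
    by (rule split)
  finally show ?thesis by (simp add: entry_def sum.distrib)
qed

lemma ip_eq_sum:
  assumes "length x = N" "length y = N"
  shows "ip x y = (\<Sum>i<N. x ! i * y ! i)"
  using assms by (simp add: ip_def sum_list_sum_nth lessThan_atLeast0)

lemma hard_weight_pos:
  assumes "x \<in> cube N" "y \<in> cube N" "j \<in> {1..2 * N}"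
  shows "0 < hard_weight N x y j"
  using entry_cube[OF assms(1,3)] entry_cube[OF assms(2,3)] assms(3)
  by (auto simp: hard_weight_def)

lemma sum_hard_weight:
  assumes "0 < N"
  shows "(\<Sum>j\<in>{1..2 * N}. hard_weight N x y j) = 1"
proof -
  define \<psi> where "\<psi> a b = (2 + (a + b) / 2) / (4 * N)" for a b :: real
  have "(\<Sum>j\<in>{1..2 * N}. hard_weight N x y j) = (\<Sum>j\<in>{1..2 * N}. \<psi> (entry N j x) (entry N j y))"
    by (intro sum.cong) (auto simp: hard_weight_def \<psi>_def)
  also have "\<dots> = (\<Sum>i<N. 1 / N)"
    unfolding sum_entry by (intro sum.cong refl) (simp add: \<psi>_def add_divide_distrib[symmetric])
  finally show ?thesis using assms by simp
qed

lemma pmf_hard_dist: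
  assumes "0 < N" "x \<in> cube N" "y \<in> cube N"
  shows "pmf (hard_dist N x y) j = hard_weight N x y j"
  unfolding hard_dist_def
proof (rule pmf_embed_pmf)
  show nn: "0 \<le> hard_weight N x y j" for j
    using hard_weight_pos[OF assms(2,3), of j] by (cases "j \<in> {1..2 * N}") (auto simp: hard_weight_def)
  have "(\<integral>\<^sup>+j. ennreal (hard_weight N x y j) \<partial>count_space UNIV)
    = (\<Sum>j\<in>{1..2 * N}. ennreal (hard_weight N x y j))"
    by (rule nn_integral_count_space') (auto simp: hard_weight_def)
  also have "\<dots> = ennreal 1"
    unfolding sum_hard_weight[OF assms(1), of x y, symmetric] by (rule sum_ennreal) (rule nn)
  finally show "(\<integral>\<^sup>+j. ennreal (hard_weight N x y j) \<partial>count_space UNIV) = 1" by simp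
qed

lemma set_pmf_hard_dist:
  assumes "0 < N" "x \<in> cube N" "y \<in> cube N"
  shows "set_pmf (hard_dist N x y) = {1..2 * N}"
proof -
  have nz: "hard_weight N x y j \<noteq> 0 \<longleftrightarrow> j \<in> {1..2 * N}" for j
    using hard_weight_pos[OF assms(2,3), of j] by (cases "j \<in> {1..2 * N}") (auto simp: hard_weight_def)
  show ?thesis unfolding set_pmf_eq pmf_hard_dist[OF assms] nz by (rule Collect_mem_eq)
qed

text \<open>In a complementary pair the linear terms cancel and the squared signs are
  \<open>1\<close>, so only the cross term \<open>x ! i * y ! i\<close> varies.\<close>

lemma l2_sq_hard_dist:
  assumes "0 < N" "x \<in> cube N" "y \<in> cube N" "2 * N \<le> n"
  shows "l2_sq n (hard_dist N x y) = (9 * real N + ip x y) / (16 * (real N)\<^sup>2)"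
proof -
  have sq: "(x ! i)\<^sup>2 = 1" "(y ! i)\<^sup>2 = 1" if "i < N" for i
    using nth_cube[OF assms(2) that] nth_cube[OF assms(3) that] by auto
  define \<psi> where "\<psi> a b = ((2 + (a + b) / 2) / (4 * N))\<^sup>2" for a b :: real
  have "l2_sq n (hard_dist N x y) = (\<Sum>j\<in>{1..2 * N}. (hard_weight N x y j)\<^sup>2)"
    unfolding l2_sq_def pmf_hard_dist[OF assms(1-3)]
  proof (rule sum.mono_neutral_right)
    show "{1..2 * N} \<subseteq> {1..n}" using assms(4) by simp
    show "\<forall>j\<in>{1..n} - {1..2 * N}. (hard_weight N x y j)\<^sup>2 = 0" by (simp add: hard_weight_def)
  qed simp
  also have "\<dots> = (\<Sum>j\<in>{1..2 * N}. \<psi> (entry N j x) (entry N j y))"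
    by (intro sum.cong) (auto simp: hard_weight_def \<psi>_def)
  also have "\<dots> = (\<Sum>i<N. (9 + x ! i * y ! i) / (16 * (real N)\<^sup>2))"
    unfolding sum_entry
  proof (intro sum.cong refl)
    fix i assume "i \<in> {..<N}"
    then have i: "i < N" by simp
    have "(2 + (a + b) / 2)\<^sup>2 + (2 + (- a + - b) / 2)\<^sup>2 = 8 + (a\<^sup>2 + b\<^sup>2) / 2 + a * b" for a b :: real
      by (simp add: power2_eq_square field_simps)
    from this[of "x ! i" "y ! i"]
    show "\<psi> (x ! i) (y ! i) + \<psi> (- x ! i) (- y ! i) = (9 + x ! i * y ! i) / (16 * (real N)\<^sup>2)"
      unfolding \<psi>_def power_divide add_divide_distrib[symmetric] sq[OF i] by (simp add: power_mult_distrib)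
  qed
  also have "\<dots> = (9 * real N + ip x y) / (16 * (real N)\<^sup>2)"
    using assms(2,3)
    by (subst ip_eq_sum[of _ N]) (auto simp: cube_def sum_divide_distrib[symmetric] sum.distrib)
  finally show ?thesis .
qed

section \<open>Probabilities of query sets through separate statistics of \<open>x\<close> and
  \<open>y\<close>\<close>

definition entry_sum :: "nat \<Rightarrow> nat set \<Rightarrow> real list \<Rightarrow> real" where
  "entry_sum N T x = (\<Sum>j\<in>T. entry N j x)"

lemma prob_hard_dist:
  assumes "0 < N" "x \<in> cube N" "y \<in> cube N"
  shows "measure_pmf.prob (hard_dist N x y) S
    = (let T = S \<inter> {1..2 * N} in (2 * card T + (entry_sum N T x + entry_sum N T y) / 2) / (4 * N))"
proof -
  let ?T = "S \<inter> {1..2 * N}"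
  have "measure_pmf.prob (hard_dist N x y) S = measure_pmf.prob (hard_dist N x y) ?T"
    using measure_Int_set_pmf[of "hard_dist N x y" S] by (simp add: set_pmf_hard_dist[OF assms])
  also have "\<dots> = (\<Sum>j\<in>?T. hard_weight N x y j)"
    by (subst measure_measure_pmf_finite) (simp_all add: pmf_hard_dist[OF assms])
  also have "\<dots> = (\<Sum>j\<in>?T. (2 + (entry N j x + entry N j y) / 2) / (4 * N))"
    by (intro sum.cong) (auto simp: hard_weight_def)
  finally show ?thesis
    unfolding Let_def entry_sum_def
    by (simp add: sum_divide_distrib[symmetric] sum.distrib)
qed

text \<open>Bounds by \<open>4 * N + 1\<close> the number of values of the statistic, hence the
  number of rectangles that a query can produce.\<close>

lemma entry_sum_range:
  assumes "x \<in> cube N" "T \<subseteq> {1..2 * N}"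
  shows "entry_sum N T x \<in> real_of_int ` {- int (2 * N)..int (2 * N)}"
proof -
  have fin: "finite T" and c: "card T \<le> 2 * N"
    using assms(2) finite_subset card_mono[OF _ assms(2)] by auto
  have "\<exists>k. entry_sum N T x = real_of_int k \<and> \<bar>k\<bar> \<le> int (card T)"
    using fin assms(2)
  proof (induction T rule: finite_induct)
    case empty
    then show ?case by (simp add: entry_sum_def)
  next
    case (insert j T)
    then obtain k where k: "entry_sum N T x = real_of_int k" "\<bar>k\<bar> \<le> int (card T)" by auto
    have "entry N j x = real_of_int 1 \<or> entry N j x = real_of_int (-1)"
      using entry_cube[OF assms(1), of j] insert.prems by auto
    then obtain b where b: "entry N j x = real_of_int b" "\<bar>b\<bar> \<le> 1"
      by (metis abs_1 abs_minus order_refl)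
    show ?case
      using insert.hyps k b by (intro exI[of _ "b + k"]) (auto simp: entry_sum_def)
  qed
  then obtain k where "entry_sum N T x = real_of_int k" "\<bar>k\<bar> \<le> int (card T)" by blast
  then show ?thesis using c by (intro image_eqI[of _ _ k]) auto
qed

subsection \<open>The adversary argument\<close>

lemma scaled_ge_neg:
  fixes p l Q :: real
  assumes "0 \<le> p" "p \<le> 1" "0 \<le> l" "- l \<le> Q"
  shows "- l \<le> p * Q"
  using mult_left_mono[OF assms(4,1)] mult_left_le_one_le[OF assms(3,1,2)] by linarith

text \<open>Dichotomy on the density \<open>V\<close>: below \<open>exp (- \<gamma> * n / 2)\<close>
  the negative part is small because squares are nonnegative; above it the entropy bound makes the
  mean of the squared inner product at least \<open>(1 - \<gamma>) * n\<close>.\<close>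

lemma second_moment_rectangle_ge:
  fixes \<gamma> p :: real
  assumes "X \<subseteq> cube n" "Y \<subseteq> cube n" "0 \<le> \<gamma>" "\<gamma> \<le> 1" "0 \<le> p" "p \<le> 1"
  shows "- (n * 4 ^ n * exp (- \<gamma> * n / 2)) \<le> (\<Sum>x\<in>X. \<Sum>y\<in>Y. p * ((ip x y)\<^sup>2 - (1 - \<gamma>) * n))"
proof -
  define Q where "Q = (\<Sum>x\<in>X. \<Sum>y\<in>Y. (ip x y)\<^sup>2 - (1 - \<gamma>) * n)"
  define V where "V = card X * card Y / (4::real) ^ n"
  have V: "0 \<le> V" by (simp add: V_def)
  have Q: "Q = (\<Sum>x\<in>X. \<Sum>y\<in>Y. (ip x y)\<^sup>2) - (1 - \<gamma>) * n * (V * 4 ^ n)"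
    unfolding Q_def V_def sum_subtractf by simp
  have "- (n * 4 ^ n * exp (- \<gamma> * n / 2)) \<le> Q"
  proof (cases "V < exp (- \<gamma> * n / 2)")
    case True
    have "(1 - \<gamma>) * (n * (V * 4 ^ n)) \<le> 1 * (n * (exp (- \<gamma> * n / 2) * 4 ^ n))"
      using assms(3,4) V True by (intro mult_mono mult_left_mono mult_right_mono) auto
    moreover have "0 \<le> (\<Sum>x\<in>X. \<Sum>y\<in>Y. (ip x y)\<^sup>2)" by (intro sum_nonneg) auto
    ultimately show ?thesis unfolding Q by (simp add: mult_ac)
  next
    case False
    then have "0 < V" using exp_gt_zero[of "- \<gamma> * n / 2"] by linarith
    then have ne: "X \<noteq> {}" "Y \<noteq> {}" by (auto simp: V_def)
    have "- \<gamma> * n / 2 \<le> ln V" using False \<open>0 < V\<close> by (subst ln_ge_iff) auto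
    then have "0 \<le> (V * 4 ^ n) * (\<gamma> * n + 2 * ln V)" using V by (intro mult_nonneg_nonneg) auto
    also have "\<dots> = card X * card Y * (n + 2 * ln (card X * card Y / 4 ^ n))
        - (1 - \<gamma>) * n * (V * 4 ^ n)"
      by (simp add: V_def algebra_simps)
    also have "\<dots> \<le> Q"
      unfolding Q using ip_second_moment_rectangle[OF assms(1) ne(1) assms(2) ne(2)] by simp
    finally have "0 \<le> Q" .
    moreover have "0 \<le> n * 4 ^ n * exp (- \<gamma> * n / 2)" by simp
    ultimately show ?thesis by linarith
  qed
  then have "- (n * 4 ^ n * exp (- \<gamma> * n / 2)) \<le> p * Q"
    by (intro scaled_ge_neg assms) auto
  then show ?thesis by (simp add: Q_def sum_distrib_left)
qed

lemma sum_rectangles: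
  fixes \<Phi> :: "'a \<Rightarrow> 'a \<Rightarrow> real"
  assumes "finite X" "finite Y" "finite K" "\<kappa> ` X \<subseteq> K" "\<kappa> ` Y \<subseteq> K"
  shows "(\<Sum>x\<in>X. \<Sum>y\<in>Y. \<Phi> x y)
    = (\<Sum>a\<in>K. \<Sum>b\<in>K. \<Sum>x\<in>{x \<in> X. \<kappa> x = a}. \<Sum>y\<in>{y \<in> Y. \<kappa> y = b}. \<Phi> x y)"
proof -
  have "(\<Sum>x\<in>X. \<Sum>y\<in>Y. \<Phi> x y) = (\<Sum>a\<in>K. \<Sum>x\<in>{x \<in> X. \<kappa> x = a}. \<Sum>y\<in>Y. \<Phi> x y)"
    by (rule sum.group[symmetric]) (use assms in auto)
  also have "\<dots> = (\<Sum>a\<in>K. \<Sum>x\<in>{x \<in> X. \<kappa> x = a}. \<Sum>b\<in>K. \<Sum>y\<in>{y \<in> Y. \<kappa> y = b}. \<Phi> x y)"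
    by (intro sum.cong refl sum.group[symmetric]) (use assms in auto)
  also have "\<dots> = (\<Sum>a\<in>K. \<Sum>b\<in>K. \<Sum>x\<in>{x \<in> X. \<kappa> x = a}. \<Sum>y\<in>{y \<in> Y. \<kappa> y = b}. \<Phi> x y)"
    by (intro sum.cong refl sum.swap)
  finally show ?thesis .
qed

text \<open>Counts the cells of one query: \<open>2 * N\<close> points, and for each of
  \<open>x\<close> and \<open>y\<close> one of \<open>4 * N + 1\<close> entry sums with one of two
  signs.\<close>

definition branching :: "nat \<Rightarrow> real" where
  "branching N = 2 * real N * (2 * (4 * real N + 1))\<^sup>2"

text \<open>For the distributions \<open>hard_dist N x y\<close> with \<open>(x, y)\<close> in a rectangle, an answer of the oracle
  restricts \<open>(x, y)\<close> to a subrectangle, on which it has constant probability. Hence a lower bound for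
  sums over arbitrary rectangles propagates from the leaves of the algorithm to its root, losing a
  factor of \<open>branching N\<close> per query.\<close>
lemma sum_output_prob_ge:
  fixes \<phi> :: "real list \<Rightarrow> real list \<Rightarrow> real"
  assumes N: "0 < N"
    and leaf: "\<And>X Y p. X \<subseteq> cube N \<Longrightarrow> Y \<subseteq> cube N \<Longrightarrow> 0 \<le> p \<Longrightarrow> p \<le> 1 \<Longrightarrow>
      - L \<le> (\<Sum>x\<in>X. \<Sum>y\<in>Y. p * \<phi> x y)"
    and "algorithm_on n A" "X \<subseteq> cube N" "Y \<subseteq> cube N"
    and "\<And>x y \<mu> m. x \<in> X \<Longrightarrow> y \<in> Y \<Longrightarrow> (\<mu>, m) \<in> set_pmf (run (hard_dist N x y) A) \<Longrightarrow> m \<le> q"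
  shows "- (L * branching N ^ q)
    \<le> (\<Sum>x\<in>X. \<Sum>y\<in>Y. output_prob (hard_dist N x y) A I * \<phi> x y)"
  using assms(3-)
proof (induction arbitrary: X Y q)
  case (1 \<mu>)
  have "1 * 1 \<le> branching N"
    unfolding branching_def using N by (intro mult_mono) (auto simp: one_le_power)
  then have "1 \<le> branching N ^ q" by (intro one_le_power) simp
  moreover have L: "0 \<le> L" using leaf[of "{}" "{}" 0] by simp
  ultimately have "L * 1 \<le> L * branching N ^ q" by (intro mult_left_mono)
  moreover have "- L \<le> (\<Sum>x\<in>X. \<Sum>y\<in>Y. measure \<mu> I * \<phi> x y)"
    using 1 by (intro leaf) (auto intro: prob_space.prob_le_1)
  ultimately show ?case by simp
next
  case (2 p)
  have on: "algorithm_on n (Random p)" using 2 by (auto intro: algorithm_on.intros)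
  have sub: "algorithm_on n A" if "A \<in> set_pmf p" for A
    using 2(1) that by blast
  have bd: "\<bar>output_prob D A I\<bar> \<le> 1" if "A \<in> set_pmf p" for A D
    using output_prob_bounds[OF sub[OF that], of D I] by simp
  have int: "integrable p (\<lambda>A. output_prob D A I)" for D
    by (rule measure_pmf.integrable_const_bound[where B = 1])
      (simp_all add: AE_measure_pmf_iff bd)
  have "- (L * branching N ^ q)
    \<le> measure_pmf.expectation p (\<lambda>A. \<Sum>x\<in>X. \<Sum>y\<in>Y. output_prob (hard_dist N x y) A I * \<phi> x y)"
  proof (rule measure_pmf.integral_ge_const)
    show "AE A in p. - (L * branching N ^ q)
        \<le> (\<Sum>x\<in>X. \<Sum>y\<in>Y. output_prob (hard_dist N x y) A I * \<phi> x y)"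
      unfolding AE_measure_pmf_iff
    proof
      fix A assume A: "A \<in> set_pmf p"
      have mq: "m \<le> q" if "x \<in> X" "y \<in> Y" "(\<mu>, m) \<in> set_pmf (run (hard_dist N x y) A)" for x y \<mu> m
        by (rule 2(4)[OF that(1,2), of \<mu>]) (use that A in auto)
      show "- (L * branching N ^ q)
          \<le> (\<Sum>x\<in>X. \<Sum>y\<in>Y. output_prob (hard_dist N x y) A I * \<phi> x y)"
        by (rule 2(1)[THEN bspec, OF A, THEN conjunct2, rule_format, OF 2(2,3)]) (rule mq)
    qed
  qed (intro Bochner_Integration.integrable_sum integrable_mult_left int)
  also have "\<dots> = (\<Sum>x\<in>X. \<Sum>y\<in>Y. output_prob (hard_dist N x y) (Random p) I * \<phi> x y)"
    by (simp add: Bochner_Integration.integral_sum int output_prob_Random[OF on])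
  finally show ?case .
next
  case (3 S k)
  note XY = 3(3,4)
  have Xc: "x \<in> cube N" if "x \<in> X" for x using that XY by blast
  have Yc: "y \<in> cube N" if "y \<in> Y" for y using that XY by blast
  have on: "algorithm_on n (Query S k)" using 3(1,2) by (simp add: algorithm_on.intros)
  have IH: "- (L * branching N ^ q) \<le> (\<Sum>x\<in>X. \<Sum>y\<in>Y. output_prob (hard_dist N x y) (k a) I * \<phi> x y)"
    if "X \<subseteq> cube N" "Y \<subseteq> cube N"
      "\<And>x y \<mu> m. x \<in> X \<Longrightarrow> y \<in> Y \<Longrightarrow> (\<mu>, m) \<in> set_pmf (run (hard_dist N x y) (k a)) \<Longrightarrow> m \<le> q"
    for a X Y q
    by (rule 3(2)[THEN spec, THEN conjunct2, rule_format, OF that(1,2)]) (rule that(3))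
  have fin: "finite X" "finite Y" using XY finite_subset[OF _ finite_cube] by auto
  have L: "0 \<le> L" using leaf[of "{}" "{}" 0] by simp
  have B0: "0 \<le> branching N" by (simp add: branching_def)
  have LB: "0 \<le> L * branching N ^ r" for r by (intro mult_nonneg_nonneg L zero_le_power B0)
  have step: "Suc m \<le> q"
    if "x \<in> X" "y \<in> Y" "a \<in> set_pmf (cond_eval (hard_dist N x y) S)"
      "(\<mu>, m) \<in> set_pmf (run (hard_dist N x y) (k a))" for x y a \<mu> m
    by (rule 3(5)[OF that(1,2), of \<mu>]) (use that(3,4) in force)
  show ?case
  proof (cases "X = {} \<or> Y = {}")
    case True
    then have "(\<Sum>x\<in>X. \<Sum>y\<in>Y. output_prob (hard_dist N x y) (Query S k) I * \<phi> x y) = 0" by auto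
    then show ?thesis using LB[of q] by simp
  next
    case False
    \<comment> \<open>An actual run on some input makes this query, so \<open>q\<close> is positive;
      an empty rectangle offers no such run.\<close>
    then obtain x0 y0 where x0: "x0 \<in> X" "y0 \<in> Y" by auto
    obtain a0 where a0: "a0 \<in> set_pmf (cond_eval (hard_dist N x0 y0) S)"
      using set_pmf_not_empty by fast
    obtain \<mu>0 m0 where "(\<mu>0, m0) \<in> set_pmf (run (hard_dist N x0 y0) (k a0))"
      using set_pmf_not_empty by (metis ex_in_conv surj_pair)
    from step[OF x0 a0 this] obtain q' where q: "q = Suc q'" by (cases q) auto
    define T where "T = S \<inter> {1..2 * N}"
    have T: "finite T" "T \<subseteq> {1..2 * N}" by (auto simp: T_def)
    have prob: "measure_pmf.prob (hard_dist N x y) S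
        = (2 * card T + (entry_sum N T x + entry_sum N T y) / 2) / (4 * N)"
      if "x \<in> X" "y \<in> Y" for x y
      unfolding T_def prob_hard_dist[OF N Xc[OF that(1)] Yc[OF that(2)]] Let_def by simp
    have supp: "set_pmf (hard_dist N x y) = {1..2 * N}" if "x \<in> X" "y \<in> Y" for x y
      by (rule set_pmf_hard_dist[OF N Xc[OF that(1)] Yc[OF that(2)]])
    show ?thesis
    proof (cases "T = {}")
      case True
      \<comment> \<open>The set misses the common support, so every input gets the failure answer
        and the rectangle is not split.\<close>
      have ce: "cond_eval (hard_dist N x y) S = return_pmf None" if "x \<in> X" "y \<in> Y" for x y
        using prob[OF that] True by (simp add: cond_eval_def entry_sum_def)
      have "- (L * branching N ^ q) \<le> (\<Sum>x\<in>X. \<Sum>y\<in>Y. output_prob (hard_dist N x y) (k None) I * \<phi> x y)"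
      proof (rule IH[OF XY])
        fix x y \<mu> m
        assume xy: "x \<in> X" "y \<in> Y" and r: "(\<mu>, m) \<in> set_pmf (run (hard_dist N x y) (k None))"
        show "m \<le> q" using step[OF xy _ r] ce[OF xy] by simp
      qed
      also have "\<dots> = (\<Sum>x\<in>X. \<Sum>y\<in>Y. output_prob (hard_dist N x y) (Query S k) I * \<phi> x y)"
        by (intro sum.cong refl) (simp add: output_prob_Query[OF on] ce)
      finally show ?thesis .
    next
      case False
      \<comment> \<open>The entry sums fix the probability of \<open>S\<close>, the entries the
        weight of \<open>j\<close>. Hence two keys fix the answer with point \<open>j\<close>, and
        \<open>\<rho>\<close> is both its last component and the probability of drawing
        \<open>j\<close>.\<close>
      define K :: "(real \<times> real) set" where "K = real_of_int ` {- int (2 * N)..int (2 * N)} \<times> {-1, 1}"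
      define key where "key j x = (entry_sum N T x, entry N j x)" for j x
      define w :: "real \<times> real \<Rightarrow> real \<times> real \<Rightarrow> real"
        where "w a b = (2 + (snd a + snd b) / 2) / (4 * N)" for a b
      define \<rho> :: "real \<times> real \<Rightarrow> real \<times> real \<Rightarrow> real"
        where "\<rho> a b = w a b / ((2 * card T + (fst a + fst b) / 2) / (4 * N))" for a b
      define ans :: "nat \<Rightarrow> real \<times> real \<Rightarrow> real \<times> real \<Rightarrow> answer"
        where "ans j a b = Some (j, w a b, \<rho> a b)" for j a b
      have key: "key j x \<in> K" if "x \<in> cube N" "j \<in> T" for j x
        using entry_sum_range[OF that(1) T(2)] entry_cube[OF that(1), of j] that(2) T(2)
        by (auto simp: K_def key_def)
      have ppos: "0 < measure_pmf.prob (hard_dist N x y) S" if "x \<in> X" "y \<in> Y" for x y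
      proof -
        obtain j where "j \<in> T" using False by auto
        then show ?thesis
          by (intro measure_pmf_posI[of j]) (auto simp: supp[OF that] T_def)
      qed
      have wt: "pmf (hard_dist N x y) j = w (key j x) (key j y)"
        and rho: "w (key j x) (key j y) / measure_pmf.prob (hard_dist N x y) S
          = \<rho> (key j x) (key j y)"
        if "x \<in> X" "y \<in> Y" "j \<in> T" for x y j
        unfolding pmf_hard_dist[OF N Xc[OF that(1)] Yc[OF that(2)]] prob[OF that(1,2)]
        using that(3) by (simp_all add: T_def hard_weight_def key_def w_def \<rho>_def)
      have ne: "set_pmf (hard_dist N x y) \<inter> S \<noteq> {}" if "x \<in> X" "y \<in> Y" for x y
        using False by (simp add: supp[OF that] T_def Int_commute)
      have setc: "set_pmf (cond_pmf (hard_dist N x y) S) = T" if "x \<in> X" "y \<in> Y" for x y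
        unfolding set_cond_pmf[OF ne[OF that]] supp[OF that] T_def by (rule Int_commute)
      have ce: "cond_eval (hard_dist N x y) S
          = map_pmf (\<lambda>j. ans j (key j x) (key j y)) (cond_pmf (hard_dist N x y) S)"
        if xy: "x \<in> X" "y \<in> Y" for x y
        unfolding cond_eval_def using ppos[OF xy]
        by (auto intro!: map_pmf_cong simp: ans_def wt[OF xy] rho[OF xy] setc[OF xy])
      have op: "output_prob (hard_dist N x y) (Query S k) I
          = (\<Sum>j\<in>T. \<rho> (key j x) (key j y)
              * output_prob (hard_dist N x y) (k (ans j (key j x) (key j y))) I)"
        if xy: "x \<in> X" "y \<in> Y" for x y
      proof -
        have "output_prob (hard_dist N x y) (Query S k) I
          = (\<Sum>j\<in>T. output_prob (hard_dist N x y) (k (ans j (key j x) (key j y))) I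
              * pmf (cond_pmf (hard_dist N x y) S) j)"
          unfolding output_prob_Query[OF on] ce[OF xy] integral_map_pmf
          by (rule integral_measure_pmf_real) (use T setc[OF xy] in auto)
        also have "\<dots> = (\<Sum>j\<in>T. \<rho> (key j x) (key j y)
              * output_prob (hard_dist N x y) (k (ans j (key j x) (key j y))) I)"
          using rho[OF xy] wt[OF xy] T_def
          by (intro sum.cong refl) (simp add: pmf_cond[OF ne[OF xy]])
        finally show ?thesis .
      qed
      define F where "F j a b x y = \<rho> a b * (output_prob (hard_dist N x y) (k (ans j a b)) I * \<phi> x y)"
        for j a b x y
      have cell: "- (L * branching N ^ q')
          \<le> (\<Sum>x\<in>{x \<in> X. key j x = a}. \<Sum>y\<in>{y \<in> Y. key j y = b}. F j a b x y)" (is "_ \<le> ?C")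
        if j: "j \<in> T" for j a b
      \<comment> \<open>Only a nonempty cell supplies an input pair showing that
        \<open>\<rho> a b\<close> is a probability.\<close>
      proof (cases "{x \<in> X. key j x = a} = {} \<or> {y \<in> Y. key j y = b} = {}")
        case True
        then have "?C = 0" by (elim disjE) (simp_all only: sum.empty sum.neutral_const)
        then show ?thesis using LB[of q'] by simp
      next
        case False
        then obtain x1 y1 where x1: "x1 \<in> X" "y1 \<in> Y" "key j x1 = a" "key j y1 = b" by auto
        have "0 \<le> \<rho> a b \<and> \<rho> a b \<le> 1"
        proof -
          have "pmf (cond_pmf (hard_dist N x1 y1) S) j = \<rho> a b"
            using rho[OF x1(1,2) j] wt[OF x1(1,2) j] j x1 by (simp add: pmf_cond[OF ne[OF x1(1,2)]] T_def)
          then show ?thesis by (metis pmf_nonneg pmf_le_1)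
        qed
        moreover have "- (L * branching N ^ q') \<le> (\<Sum>x\<in>{x \<in> X. key j x = a}. \<Sum>y\<in>{y \<in> Y. key j y = b}.
            output_prob (hard_dist N x y) (k (ans j a b)) I * \<phi> x y)" (is "_ \<le> ?R")
        proof (rule IH)
          fix x y \<mu> m
          assume x: "x \<in> {x \<in> X. key j x = a}" and y: "y \<in> {y \<in> Y. key j y = b}"
            and r: "(\<mu>, m) \<in> set_pmf (run (hard_dist N x y) (k (ans j a b)))"
          have "ans j a b \<in> set_pmf (cond_eval (hard_dist N x y) S)"
            using x y j by (auto simp: ce setc)
          from step[OF _ _ this r] x y show "m \<le> q'" by (simp add: q)
        qed (use XY in auto)
        moreover have "?C = \<rho> a b * ?R" by (simp add: F_def sum_distrib_left)
        ultimately show ?thesis using scaled_ge_neg[OF _ _ LB] by simp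
      qed
      have "card K = card (real_of_int ` {- int (2 * N)..int (2 * N)}) * 2"
        by (simp add: K_def card_cartesian_product)
      also have "card (real_of_int ` {- int (2 * N)..int (2 * N)}) = 4 * N + 1"
        by (subst card_image) (auto simp: inj_on_def)
      finally have cK: "card K = 2 * (4 * N + 1)" by simp
      have finK: "finite K" by (simp add: K_def)
      have cT: "real (card T) \<le> 2 * N" using card_mono[OF _ T(2)] by simp
      have "- (L * branching N ^ q) = (2 * N * (real (card K))\<^sup>2) * - (L * branching N ^ q')"
        by (simp add: q cK branching_def)
      also have "\<dots> \<le> (card T * (real (card K))\<^sup>2) * - (L * branching N ^ q')"
        using LB[of q'] cT by (intro mult_right_mono_neg mult_right_mono) auto
      also have "\<dots> = (\<Sum>j\<in>T. \<Sum>a\<in>K. \<Sum>b\<in>K. - (L * branching N ^ q'))"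
        by (simp add: power2_eq_square mult_ac)
      also have "\<dots> \<le> (\<Sum>j\<in>T. \<Sum>a\<in>K. \<Sum>b\<in>K. \<Sum>x\<in>{x \<in> X. key j x = a}.
          \<Sum>y\<in>{y \<in> Y. key j y = b}. F j a b x y)"
        by (intro sum_mono cell)
      also have "\<dots> = (\<Sum>j\<in>T. \<Sum>a\<in>K. \<Sum>b\<in>K. \<Sum>x\<in>{x \<in> X. key j x = a}.
          \<Sum>y\<in>{y \<in> Y. key j y = b}. F j (key j x) (key j y) x y)"
        by (intro sum.cong refl) auto
      also have "\<dots> = (\<Sum>j\<in>T. \<Sum>x\<in>X. \<Sum>y\<in>Y. F j (key j x) (key j y) x y)"
        by (intro sum.cong refl sum_rectangles[symmetric] fin finK) (use key XY in auto)
      also have "\<dots> = (\<Sum>x\<in>X. \<Sum>y\<in>Y. \<Sum>j\<in>T. F j (key j x) (key j y) x y)"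
        by (subst sum.swap) (intro sum.cong refl sum.swap)
      also have "\<dots> = (\<Sum>x\<in>X. \<Sum>y\<in>Y. output_prob (hard_dist N x y) (Query S k) I * \<phi> x y)"
        by (intro sum.cong refl) (simp add: op F_def sum_distrib_right mult.assoc)
      finally show ?thesis .
    qed
  qed
qed

text \<open>Reporting an estimate in \<open>I\<close> has probability at least \<open>2 / 3\<close>
  for inner products up to \<open>39 / 40 * sqrt N\<close> and at most \<open>1 / 3\<close> from
  \<open>sqrt N\<close> on. This makes a weighted sum clearly negative, against the rectangle
  bound.\<close>

lemma branching_power_ge:
  assumes N: "4 \<le> N" "2 * N \<le> n" and \<epsilon>: "0 < \<epsilon>" "800 * \<epsilon> * sqrt N < 1"
    and A: "algorithm_on n A" "estimates_l2_sq n \<epsilon> A" "makes_at_most_queries n A q"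
  shows "2 / 45 \<le> exp (- real N / 60) * branching N ^ q"
proof -
  define r where "r = sqrt N"
  \<comment> \<open>The midpoint of \<open>39 / 40 * r\<close> and \<open>r\<close>. The relative
    error shifts the numerator by at most \<open>9 * \<epsilon> * N + \<epsilon> * r\<close> at the
    edges of this window, less than its half-width \<open>r / 80\<close>; hence the
    \<open>800\<close> in the hypothesis.\<close>
  define t where "t = 79 / 80 * r"
  define I where "I = {(9 * N - t) / (16 * (real N)\<^sup>2) .. (9 * N + t) / (16 * (real N)\<^sup>2)}"
  define acc where "acc x y = output_prob (hard_dist N x y) A I" for x y
  have N0: "0 < N" using N by simp
  have r: "r\<^sup>2 = N" "0 < r" "1 \<le> r" using N by (simp_all add: r_def)
  have rN: "r \<le> N" using r mult_left_mono[OF r(3), of r] by (simp add: power2_eq_square)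
  have "800 * \<epsilon> * r * r < 1 * r" using \<epsilon>(2) r(2) by (intro mult_strict_right_mono) (auto simp: r_def)
  then have \<epsilon>N: "800 * (\<epsilon> * N) < r" unfolding r(1)[symmetric] by (simp add: power2_eq_square mult_ac)
  have \<epsilon>r: "\<epsilon> * r \<le> \<epsilon> * N" using rN \<epsilon>(1) by simp

  have D: "hard_dist N x y \<in> distributions_on n" if "x \<in> cube N" "y \<in> cube N" for x y
    using set_pmf_hard_dist[OF N0 that] N by (simp add: distributions_on_def)
  define E where "E x y = {z. l2_sq n (hard_dist N x y) / (1 + \<epsilon>) \<le> z
      \<and> z \<le> (1 + \<epsilon>) * l2_sq n (hard_dist N x y)}" for x y
  have E: "2 / 3 \<le> output_prob (hard_dist N x y) A (E x y)" if "x \<in> cube N" "y \<in> cube N" for x y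
    using A(2) D[OF that] by (simp add: estimates_l2_sq_def E_def)
  have Eeq: "E x y = {(9 * N + ip x y) / (16 * (real N)\<^sup>2) / (1 + \<epsilon>)
      .. (1 + \<epsilon>) * ((9 * N + ip x y) / (16 * (real N)\<^sup>2))}" if "x \<in> cube N" "y \<in> cube N" for x y
    by (auto simp: E_def l2_sq_hard_dist[OF N0 that N(2)])
  have exp1: "(9 * N - u) * (1 + \<epsilon>) = 9 * N - u + 9 * (\<epsilon> * N) - \<epsilon> * u"
    and exp2: "(1 + \<epsilon>) * (9 * N + u) = 9 * N + u + 9 * (\<epsilon> * N) + \<epsilon> * u"
    and exp3: "(9 * N + u) * (1 + \<epsilon>) = 9 * N + u + 9 * (\<epsilon> * N) + \<epsilon> * u" for u :: real
    by (simp_all add: algebra_simps)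
  have pos: "0 < 16 * (real N)\<^sup>2" using N0 by simp

  have small: "2 / 3 \<le> acc x y" if xy: "x \<in> cube N" "y \<in> cube N" and s: "\<bar>ip x y\<bar> \<le> 39 / 40 * r" for x y
  proof -
    have "\<epsilon> * ip x y \<le> \<epsilon> * r" using s r \<epsilon>(1) by (intro mult_left_mono) auto
    then have up: "(1 + \<epsilon>) * (9 * N + ip x y) \<le> 9 * N + t"
      using s \<epsilon>N \<epsilon>r unfolding exp2 t_def by linarith
    have "0 \<le> \<epsilon> * t" using \<epsilon>(1) r by (simp add: t_def)
    then have "(9 * N - t) * (1 + \<epsilon>) \<le> 9 * N + ip x y"
      using s \<epsilon>N r unfolding exp1 t_def by linarith
    then have lo: "9 * N - t \<le> (9 * N + ip x y) / (1 + \<epsilon>)"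
      using \<epsilon>(1) by (simp add: pos_le_divide_eq)
    have "E x y \<subseteq> I"
      unfolding Eeq[OF xy] I_def using divide_right_mono[OF up, of "16 * (real N)\<^sup>2"]
        divide_right_mono[OF lo, of "16 * (real N)\<^sup>2"] by (simp add: mult.commute)
    then have "output_prob (hard_dist N x y) A (E x y) \<le> acc x y"
      unfolding acc_def by (intro output_prob_mono[OF A(1)]) (simp_all add: I_def)
    then show ?thesis using E[OF xy] by linarith
  qed
  have large: "acc x y \<le> 1 / 3" if xy: "x \<in> cube N" "y \<in> cube N" and s: "r \<le> \<bar>ip x y\<bar>" for x y
  proof -
    have "E x y \<inter> I = {}"
    proof (cases "0 \<le> ip x y")
      case True
      have "\<epsilon> * t \<le> \<epsilon> * r" using r \<epsilon>(1) by (intro mult_left_mono) (auto simp: t_def)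
      then have "(9 * N + t) * (1 + \<epsilon>) < 9 * N + ip x y"
        using s True \<epsilon>N \<epsilon>r unfolding exp3 t_def by linarith
      then have "9 * N + t < (9 * N + ip x y) / (1 + \<epsilon>)"
        using \<epsilon>(1) by (simp add: pos_less_divide_eq)
      from divide_strict_right_mono[OF this pos] show ?thesis
        unfolding Eeq[OF xy] I_def by (simp add: mult.commute)
    next
      case False
      have "\<epsilon> * ip x y \<le> 0" using False \<epsilon>(1) by (simp add: mult_nonneg_nonpos)
      then have "(1 + \<epsilon>) * (9 * N + ip x y) < 9 * N - t"
        using s False \<epsilon>N r unfolding exp2 t_def by linarith
      from divide_strict_right_mono[OF this pos] show ?thesis
        unfolding Eeq[OF xy] I_def by simp
    qed
    then have "output_prob (hard_dist N x y) A (E x y) + acc x y \<le> 1"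
      unfolding acc_def by (intro output_prob_disjoint[OF A(1)]) (simp_all add: I_def Eeq[OF xy])
    then show ?thesis using E[OF xy] by linarith
  qed

  \<comment> \<open>The window \<open>39 / 40 * r < \<bar>ip x y\<bar> < r\<close>, where nothing is known about \<open>acc\<close>, accounts for the term
    with \<open>79 / 2400 = 2 / 3 * (1 - (39 / 40)\<^sup>2)\<close>.\<close>
  have pt: "acc x y * ((ip x y)\<^sup>2 - (1 - 1 / 30) * N)
      \<le> 1 / 3 * (ip x y)\<^sup>2 - 1 / 3 * max 0 (N - (ip x y)\<^sup>2) + (- real N / 3 + 79 / 2400 * N + 1 / 30 * N)"
    if xy: "x \<in> cube N" "y \<in> cube N" for x y
  proof -
    define s2 where "s2 = (ip x y)\<^sup>2"
    have acc: "0 \<le> acc x y" "acc x y \<le> 1" using output_prob_bounds[OF A(1)] by (auto simp: acc_def)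
    have "acc x y * real N \<le> 1 * real N" using acc by (intro mult_right_mono) auto
    \<comment> \<open>Without the window term, the right-hand side is
      \<open>2 / 3 * (s2 - N)\<close> below \<open>N\<close> and \<open>1 / 3 * (s2 - N)\<close>
      above.\<close>
    moreover have "acc x y * (s2 - N) \<le> 1 / 3 * s2 - 1 / 3 * max 0 (N - s2) + (- real N / 3 + 79 / 2400 * N)"
    proof (cases "r \<le> \<bar>ip x y\<bar>")
      case True
      then have "N \<le> s2" using power_mono[OF True, of 2] r by (simp add: s2_def)
      then have "acc x y * (s2 - N) \<le> 1 / 3 * (s2 - N)"
        using large[OF xy True] by (intro mult_right_mono) auto
      then show ?thesis using \<open>N \<le> s2\<close> by simp
    next
      case False
      then have "s2 \<le> N" using power_mono[of "\<bar>ip x y\<bar>" r 2] r by (simp add: s2_def)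
      then have mx: "max 0 (N - s2) = N - s2" by simp
      show ?thesis
      proof (cases "\<bar>ip x y\<bar> \<le> 39 / 40 * r")
        case True
        have "acc x y * (s2 - N) \<le> 2 / 3 * (s2 - N)"
          using small[OF xy True] \<open>s2 \<le> N\<close> by (intro mult_right_mono_neg) auto
        then show ?thesis unfolding mx by (simp add: field_simps)
      next
        case False
        then have "(39 / 40 * r)\<^sup>2 \<le> \<bar>ip x y\<bar>\<^sup>2" using r by (intro power_mono) auto
        then have "1521 / 1600 * N \<le> s2" using r(1) by (simp add: s2_def power_mult_distrib power_divide)
        moreover have "acc x y * (s2 - N) \<le> 0"
          using acc \<open>s2 \<le> N\<close> by (intro mult_nonneg_nonpos) auto
        ultimately show ?thesis unfolding mx by (simp add: field_simps)
      qed
    qed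
    ultimately show ?thesis unfolding s2_def[symmetric] by (simp add: algebra_simps)
  qed

  have "- (N * 4 ^ N * exp (- (1 / 30) * N / 2) * branching N ^ q)
    \<le> (\<Sum>x\<in>cube N. \<Sum>y\<in>cube N. acc x y * ((ip x y)\<^sup>2 - (1 - 1 / 30) * N))"
    unfolding acc_def
  proof (rule sum_output_prob_ge[OF N0 _ A(1)])
    show "m \<le> q" if "x \<in> cube N" "y \<in> cube N" "(\<mu>, m) \<in> set_pmf (run (hard_dist N x y) A)" for x y \<mu> m
      using A(3) D[OF that(1,2)] that(3) by (auto simp: makes_at_most_queries_def)
  qed (simp_all add: second_moment_rectangle_ge[of _ _ _ "1 / 30", simplified])
  also have "\<dots> \<le> (\<Sum>x\<in>cube N. \<Sum>y\<in>cube N. 1 / 3 * (ip x y)\<^sup>2 - 1 / 3 * max 0 (N - (ip x y)\<^sup>2)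
      + (- real N / 3 + 79 / 2400 * N + 1 / 30 * N) * 1)"
    unfolding mult_1_right by (intro sum_mono pt)
  also have "\<dots> = 1 / 3 * (real N * 4 ^ N) - 1 / 3 * (\<Sum>x\<in>cube N. \<Sum>y\<in>cube N. max 0 (N - (ip x y)\<^sup>2))
      + (- real N / 3 + 79 / 2400 * N + 1 / 30 * N) * 4 ^ N"
    unfolding sum.distrib sum_subtractf sum_distrib_left[symmetric] ip_moment_2 ip_moment_0 ..
  \<comment> \<open>The coefficients of \<open>P\<close> add up to
    \<open>- 1 / 9 + 79 / 2400 + 1 / 30\<close>, which is below \<open>- 2 / 45\<close>.\<close>
  also have "\<dots> \<le> - (2 / 45) * (real N * 4 ^ N)"
  proof -
    define P where "P = real N * 4 ^ N"
    have "(- real N / 3 + 79 / 2400 * N + 1 / 30 * N) * 4 ^ N = (- 1 / 3 + 79 / 2400 + 1 / 30) * P"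
      by (simp add: P_def algebra_simps)
    moreover have "1 / 3 * P \<le> (\<Sum>x\<in>cube N. \<Sum>y\<in>cube N. max 0 (N - (ip x y)\<^sup>2))"
      using ip_sq_below_mean[OF N(1)] by (simp add: P_def)
    moreover have "0 \<le> P" by (simp add: P_def)
    ultimately show ?thesis unfolding P_def[symmetric] by simp
  qed
  finally have "(2 / 45) * (real N * 4 ^ N) \<le> exp (- real N / 60) * branching N ^ q * (real N * 4 ^ N)"
    by (simp add: mult_ac)
  then show ?thesis using N0 by (subst (asm) mult_le_cancel_right) simp_all
qed

text \<open>Take logarithms, with \<open>branching N \<le> n ^ 4\<close> from
  \<open>36 \<le> n\<close>. Since \<open>ln (45 / 2) \<le> 5\<close> and
  \<open>600 \<le> N\<close>, the constant costs at most half of \<open>N / 60\<close>.\<close>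

lemma queries_ge:
  assumes N: "600 \<le> N" "2 * N \<le> n" "36 \<le> n" and b: "2 / 45 \<le> exp (- real N / 60) * branching N ^ q"
  shows "N / (480 * ln n) \<le> q"
proof -
  have n: "36 \<le> real n" using N by simp
  have "branching N \<le> real n * (6 * real n)\<^sup>2"
  proof -
    have "2 * (4 * real N + 1) \<le> 6 * real n" using N by simp
    from power_mono[OF this, of 2] show ?thesis
      unfolding branching_def using N by (intro mult_mono) auto
  qed
  also have "\<dots> \<le> n ^ 4"
    using mult_right_mono[OF n, of "real n ^ 3"] by (simp add: eval_nat_numeral)
  finally have "branching N ^ q \<le> (real n ^ 4) ^ q"
    by (intro power_mono) (simp_all add: branching_def)
  then have "2 / 45 \<le> exp (- real N / 60) * (real n ^ 4) ^ q"
    using b by (meson exp_ge_zero mult_left_mono order_trans)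
  then have "ln (2 / 45) \<le> ln (exp (- real N / 60) * (real n ^ 4) ^ q)"
    using n by (subst ln_le_cancel_iff) auto
  also have "\<dots> = - real N / 60 + q * (4 * ln n)"
    using n by (simp add: ln_mult ln_realpow)
  finally have 1: "N / 60 + ln (2 / 45) \<le> q * (4 * ln n)" by simp
  have "exp 1 \<ge> (2::real)" using exp_ge_add_one_self[of 1] by simp
  then have "(2::real) ^ 5 \<le> exp 1 ^ 5" by (intro power_mono) auto
  then have "(32::real) \<le> exp 5" by (simp add: exp_of_nat_mult[symmetric])
  then have "ln (45 / 2) \<le> ln (exp (5::real))" by (subst ln_le_cancel_iff) auto
  then have "- 5 \<le> ln (2 / 45 :: real)" using ln_inverse[of "45 / 2 :: real"] by simp
  then have "N / 120 \<le> q * (4 * ln n)" using 1 N(1) by simp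
  then show ?thesis using n by (simp add: divide_le_eq mult_ac)
qed

section \<open>Choice of the dimension and the constants\<close>

theorem theorem4p4:
  fixes \<alpha> :: real
  assumes "0 < \<alpha>" and "\<alpha> < 1 / 2"
  shows "\<exists>c>0. \<forall>\<^sub>F n in sequentially. \<forall>\<epsilon> A q.
           \<epsilon> = real n powr (- \<alpha>) \<longrightarrow>
           algorithm_on n A \<longrightarrow>
           estimates_l2_sq n \<epsilon> A \<longrightarrow>
           makes_at_most_queries n A q \<longrightarrow>
           real q \<ge> c * (1 / (\<epsilon>\<^sup>2 * ln (1 / \<epsilon>)))"
\<comment> \<open>\<open>960000000 = 480 * 2000000\<close>: the first factor is from
  \<open>queries_ge\<close>, the second from \<open>M / 2000000 \<le> N\<close>;
  \<open>\<alpha>\<close> comes from \<open>ln (1 / \<epsilon>) = \<alpha> * ln n\<close>.\<close>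
proof (intro exI[of _ "\<alpha> / 960000000"] conjI)
  show "0 < \<alpha> / 960000000" using assms by simp
  \<comment> \<open>The second term ensures \<open>10 ^ 9 \<le> M\<close>, so that \<open>N\<close>
    exceeds \<open>600\<close> and rounding down loses less than half.\<close>
  define n0 where "n0 = max 36 (nat \<lceil>(10 ^ 9) powr (1 / (2 * \<alpha>))\<rceil>)"
  have "real q \<ge> \<alpha> / 960000000 * (1 / (\<epsilon>\<^sup>2 * ln (1 / \<epsilon>)))"
    if n: "n0 \<le> n" and \<epsilon>: "\<epsilon> = real n powr (- \<alpha>)" and A: "algorithm_on n A" "estimates_l2_sq n \<epsilon> A"
      "makes_at_most_queries n A q" for n \<epsilon> A q
  proof -
    have n36: "36 \<le> n" using n by (simp add: n0_def)
    then have n0: "0 < real n" "1 < real n" by simp_all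
    have "(10 ^ 9) powr (1 / (2 * \<alpha>)) \<le> real n" using n by (simp add: n0_def)
    then have "((10 ^ 9) powr (1 / (2 * \<alpha>))) powr (2 * \<alpha>) \<le> real n powr (2 * \<alpha>)"
      using assms by (intro powr_mono2) auto
    then have big: "10 ^ 9 \<le> real n powr (2 * \<alpha>)" using assms by (simp add: powr_powr)
    define M where "M = real n powr (2 * \<alpha>)"
    have \<epsilon>0: "0 < \<epsilon>" using n0 by (simp add: \<epsilon>)
    have \<epsilon>2: "\<epsilon>\<^sup>2 * M = 1"
      using n0 by (simp add: \<epsilon> M_def power2_eq_square powr_add[symmetric])
    \<comment> \<open>Here \<open>\<alpha> < 1 / 2\<close> enters: the \<open>2 * N\<close> support
      points must fit into \<open>{1..n}\<close>.\<close>
    have Mn: "M \<le> n"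
      using powr_mono[of "2 * \<alpha>" 1 "real n"] assms n0 by (simp add: M_def)
    \<comment> \<open>As \<open>M\<close> is the inverse square of \<open>\<epsilon>\<close>, this
      gives \<open>800 * \<epsilon> * sqrt N \<le> 4 / 5\<close>.\<close>
    define N where "N = nat \<lfloor>M / 10 ^ 6\<rfloor>"
    have NM: "real N \<le> M / 10 ^ 6" "M / 10 ^ 6 - 1 < real N"
      using big unfolding N_def M_def[symmetric] by simp_all linarith
    have N: "600 \<le> N" "2 * N \<le> n" using NM big Mn unfolding M_def[symmetric] by simp_all
    have "(800 * \<epsilon> * sqrt N)\<^sup>2 = 640000 * \<epsilon>\<^sup>2 * N" by (simp add: power_mult_distrib)
    also have "\<dots> \<le> 640000 * \<epsilon>\<^sup>2 * (M / 10 ^ 6)" by (intro mult_left_mono NM) simp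
    also have "\<dots> = 16 / 25 * (\<epsilon>\<^sup>2 * M)" by simp
    also have "\<dots> < 1\<^sup>2" unfolding \<epsilon>2 by simp
    finally have "800 * \<epsilon> * sqrt N < 1" by (rule power_less_imp_less_base) simp
    then have q: "N / (480 * ln n) \<le> q"
      using N n36 \<epsilon>0 A by (intro queries_ge branching_power_ge[of N n \<epsilon> A]) auto
    have lnn: "0 < ln n" using n0 by simp
    have ln\<epsilon>: "ln (1 / \<epsilon>) = \<alpha> * ln n" using n0 by (simp add: \<epsilon> ln_div ln_powr)
    have "1 / \<epsilon>\<^sup>2 = M" using \<epsilon>2 \<epsilon>0 by (simp add: field_simps)
    then have "\<alpha> / 960000000 * (1 / (\<epsilon>\<^sup>2 * ln (1 / \<epsilon>))) = (M / 2000000) / (480 * ln n)"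
      unfolding ln\<epsilon> using assms lnn by (simp add: field_simps)
    also have "\<dots> \<le> N / (480 * ln n)"
      using NM big lnn unfolding M_def[symmetric] by (intro divide_right_mono) auto
    finally show ?thesis using q by linarith
  qed
  then show "\<forall>\<^sub>F n in sequentially. \<forall>\<epsilon> A q.
           \<epsilon> = real n powr (- \<alpha>) \<longrightarrow>
           algorithm_on n A \<longrightarrow>
           estimates_l2_sq n \<epsilon> A \<longrightarrow>
           makes_at_most_queries n A q \<longrightarrow>
           real q \<ge> \<alpha> / 960000000 * (1 / (\<epsilon>\<^sup>2 * ln (1 / \<epsilon>)))"
    by (intro eventually_mono[OF eventually_ge_at_top[of n0]] allI impI)
qed

end
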